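(* Let $p$ be a prime and let $H=E_{p^3}$ be an elementary abelian group of order $p^3$. Denote by $\mathcal{E}_p$ the class of all transitive permutation $p$-groups of degree $p^3$ whose action on some imprimitivity system induces a regular group isomorphic to $E_{p^2}$. Then there exists a group $\Gamma\in\mathcal{E}_p$ such that $b_H(\Gamma)\ge p^{p-2}$.
   Context: $E_{p^n}$ denotes an elementary abelian $p$-group of order $p^n$. A permutation group on a set is regular if it is transitive and all its point stabilizers are trivial. An imprimitivity system of a transitive permutation group is a partition of the underlying set into blocks that is invariant under the group; the group then acts on the set of blocks, and the permutation group induced on the set of blocks is the image of this action. For a group $H$ and a permutation group $\Gamma$, $\mathrm{Reg}(\Gamma,H)$ denotes the set of all regular subgroups of $\Gamma$ that are isomorphic to $H$. The group $\Gamma$ acts on $\mathrm{Reg}(\Gamma,H)$ by conjugation, and $b_H(\Gamma)$ denotes the number of orbits of this action, i.e. the number of $\Gamma$-conjugacy classes of regular subgroups of $\Gamma$ isomorphic to $H$. *)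

theory Defs
  imports
    "HOL-Algebra.Group_Action"
    "HOL-Algebra.Multiplicative_Group"
    "HOL-Computational_Algebra.Primes"
    "HOL-Library.Disjoint_Sets"
begin

definition p_group :: "nat \<Rightarrow> ('a, 'm) monoid_scheme \<Rightarrow> bool" where
  "p_group p G \<longleftrightarrow> group G \<and> (\<exists>k. order G = p ^ k)"

definition elementary_abelian :: "nat \<Rightarrow> nat \<Rightarrow> ('a, 'm) monoid_scheme \<Rightarrow> bool" where
  \<comment> \<open>\<open>G\<close> is a copy of $E_{p^n}$; the predicate is invariant under isomorphism.\<close>
  "elementary_abelian p n G \<longleftrightarrow>
     comm_group G \<and> order G = p ^ n \<and>
     (\<forall>x \<in> carrier G. x \<noteq> \<one>\<^bsub>G\<^esub> \<longrightarrow> group.ord G x = p)"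

text \<open>
  A permutation group on \<open>\<Omega>\<close> is a subset \<open>\<Gamma>\<close> of the carrier of \<^term>\<open>BijGroup \<Omega>\<close> (whose
  elements are extensional functions) forming a subgroup; it acts on \<open>\<Omega>\<close> via the identity map.
\<close>

abbreviation perm_group :: "'a set \<Rightarrow> ('a \<Rightarrow> 'a) set \<Rightarrow> ('a \<Rightarrow> 'a) monoid" where
  "perm_group \<Omega> \<Gamma> \<equiv> (BijGroup \<Omega>)\<lparr>carrier := \<Gamma>\<rparr>"

definition transitive_perm_group :: "'a set \<Rightarrow> ('a \<Rightarrow> 'a) set \<Rightarrow> bool" where
  "transitive_perm_group \<Omega> \<Gamma> \<longleftrightarrow>
     subgroup \<Gamma> (BijGroup \<Omega>) \<and> transitive_action (perm_group \<Omega> \<Gamma>) \<Omega> (\<lambda>g. g)"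

definition regular_perm_group :: "'a set \<Rightarrow> ('a \<Rightarrow> 'a) set \<Rightarrow> bool" where
  "regular_perm_group \<Omega> \<Gamma> \<longleftrightarrow>
     transitive_perm_group \<Omega> \<Gamma> \<and>
     (\<forall>x \<in> \<Omega>. stabilizer (perm_group \<Omega> \<Gamma>) (\<lambda>g. g) x = {\<one>\<^bsub>perm_group \<Omega> \<Gamma>\<^esub>})"

definition imprimitivity_system :: "'a set \<Rightarrow> ('a \<Rightarrow> 'a) set \<Rightarrow> 'a set set \<Rightarrow> bool" where
  "imprimitivity_system \<Omega> \<Gamma> \<B> \<longleftrightarrow>
     partition_on \<Omega> \<B> \<and> (\<forall>g \<in> \<Gamma>. \<forall>B \<in> \<B>. g ` B \<in> \<B>)"

definition block_action :: "'a set set \<Rightarrow> ('a \<Rightarrow> 'a) \<Rightarrow> 'a set \<Rightarrow> 'a set" where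
  "block_action \<B> g = (\<lambda>B \<in> \<B>. g ` B)"

definition induced_group :: "'a set set \<Rightarrow> ('a \<Rightarrow> 'a) set \<Rightarrow> ('a set \<Rightarrow> 'a set) set" where
  "induced_group \<B> \<Gamma> = block_action \<B> ` \<Gamma>"

definition class_E :: "nat \<Rightarrow> 'a set \<Rightarrow> ('a \<Rightarrow> 'a) set set" where
  \<comment> \<open>the members of $\mathcal{E}_p$ whose set of points is \<open>\<Omega>\<close>\<close>
  "class_E p \<Omega> =
     {\<Gamma>. card \<Omega> = p ^ 3 \<and> transitive_perm_group \<Omega> \<Gamma> \<and> p_group p (perm_group \<Omega> \<Gamma>) \<and>
         (\<exists>\<B>. imprimitivity_system \<Omega> \<Gamma> \<B> \<and>
              regular_perm_group \<B> (induced_group \<B> \<Gamma>) \<and>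
              elementary_abelian p 2 (perm_group \<B> (induced_group \<B> \<Gamma>)))}"

definition Reg :: "'a set \<Rightarrow> ('a \<Rightarrow> 'a) set \<Rightarrow> ('h, 'm) monoid_scheme \<Rightarrow> ('a \<Rightarrow> 'a) set set" where
  "Reg \<Omega> \<Gamma> H =
     {R. subgroup R (perm_group \<Omega> \<Gamma>) \<and> regular_perm_group \<Omega> R \<and> perm_group \<Omega> R \<cong> H}"

definition conj_action ::
  "'a set \<Rightarrow> ('a \<Rightarrow> 'a) set \<Rightarrow> ('h, 'm) monoid_scheme \<Rightarrow> ('a \<Rightarrow> 'a) \<Rightarrow>
   ('a \<Rightarrow> 'a) set \<Rightarrow> ('a \<Rightarrow> 'a) set" where
  "conj_action \<Omega> \<Gamma> H g =
     (\<lambda>R \<in> Reg \<Omega> \<Gamma> H.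
        g <#\<^bsub>perm_group \<Omega> \<Gamma>\<^esub> R #>\<^bsub>perm_group \<Omega> \<Gamma>\<^esub> (inv\<^bsub>perm_group \<Omega> \<Gamma>\<^esub> g))"

definition num_reg_classes :: "'a set \<Rightarrow> ('a \<Rightarrow> 'a) set \<Rightarrow> ('h, 'm) monoid_scheme \<Rightarrow> nat" where
  \<comment> \<open>$b_H(\Gamma)$\<close>
  "num_reg_classes \<Omega> \<Gamma> H =
     card (orbits (perm_group \<Omega> \<Gamma>) (Reg \<Omega> \<Gamma> H) (conj_action \<Omega> \<Gamma> H))"

end

theory Submission
  imports Defs "HOL-Algebra.Sylow" "HOL-Number_Theory.Cong"
begin

text \<open>
  The points are the triples \<open>(x, y, z)\<close> of residues modulo \<open>p\<close>, coded as the natural numbers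
  below \<open>p ^ 3\<close>. The group \<open>\<Gamma>\<close> consists of the shears \<open>(x, y, z) \<mapsto> (x + a, y + b, z + f x y)\<close>,
  where \<open>f\<close> ranges over the space \<open>V\<close> of functions that are annihilated by every mixed difference
  operator of order \<open>p - 1\<close>, that is, over the polynomial functions in \<open>x\<close> and \<open>y\<close> of total degree
  at most \<open>p - 2\<close>. This space contains the constants and is invariant under translations, so \<open>\<Gamma>\<close>
  is a transitive group. The \<open>p\<close>-th power of a shear fixes \<open>x\<close> and \<open>y\<close>, so its own \<open>p\<close>-th power is
  trivial, and \<open>\<Gamma>\<close> is a \<open>p\<close>-group. On the vertical lines (the fibres of \<open>(x, y, z) \<mapsto> (x, y)\<close>) it
  induces the translations of a plane, so it belongs to the class \<^term>\<open>class_E p\<close> (lemma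
  \<open>\<Gamma>_in_class_E\<close>).

  Conjugating the translation group of the cube with \<open>(x, y, z) \<mapsto> (x, y, z + h x y)\<close> gives a
  regular elementary abelian group. It consists of the shears with \<open>f x y = h (x + a) (y + b) - h
  x y + c\<close>, and it lies in \<open>\<Gamma>\<close> as soon as all first differences of \<open>h\<close> belong to \<open>V\<close>. The function
  \<open>h\<close> itself may have degree \<open>p - 1\<close>, one more than the elements of \<open>V\<close>, and this is where the
  many classes come from. If two such groups, for \<open>h\<close> and \<open>h'\<close>, are conjugate under a shear of
  \<open>\<Gamma>\<close>, then \<open>h\<close> differs from a translate of \<open>h'\<close> by an element of \<open>V\<close> and a function with constant
  first differences. Hence, modulo \<open>p\<close>, \<open>h\<close> and that translate have the same differences of order
  \<open>i\<close> in \<open>x\<close> and \<open>j\<close> in \<open>y\<close>, for all positive \<open>i\<close> and \<open>j\<close> with \<open>i + j = p - 1\<close> (lemma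
  \<open>conjugate_twisted_invariant\<close>). Products of binomial coefficients are dual to these operators:
  the function that maps \<open>(x, y)\<close> to the sum of \<open>s i * (x choose i) * (y choose (p - 1 - i))\<close> over
  \<open>1 \<le> i \<le> p - 2\<close> has the constant \<open>s i\<close> as its difference of order \<open>(i, p - 1 - i)\<close>. So the \<open>p ^
  (p - 2)\<close> choices of \<open>s\<close> modulo \<open>p\<close> give pairwise non-conjugate subgroups (lemma
  \<open>orbit_determines_potential\<close>). Finally, every such subgroup is isomorphic to \<open>H\<close>, because an
  elementary abelian group is determined by its order (\<open>elementary_abelian_unique\<close>).
\<close>

section \<open>Elementary abelian groups and $p$-groups\<close>

lemma (in group) pow_cong_exponent:
  assumes "x \<in> carrier G" "x [^] (p::nat) = \<one>" "[a = b] (mod p)"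
  shows "x [^] a = x [^] b"
proof -
  have "x [^] (n mod p) = x [^] n" for n :: nat
  proof -
    have "x [^] n = x [^] (p * (n div p) + n mod p)" by simp
    also have "\<dots> = (x [^] p) [^] (n div p) \<otimes> x [^] (n mod p)"
      using assms(1) by (simp add: nat_pow_mult nat_pow_pow)
    finally show ?thesis using assms by simp
  qed
  then show ?thesis using assms(3) by (metis cong_def)
qed

text \<open>
  The group element with exponent vector \<open>v\<close> in the generators \<open>xs\<close>.  In an elementary abelian group
  this is a linear combination, written multiplicatively; all exponents are natural numbers, and
  only their residues modulo \<open>p\<close> matter.
\<close>

definition monomial :: "('a, 'm) monoid_scheme \<Rightarrow> (nat \<Rightarrow> 'a) \<Rightarrow> nat \<Rightarrow> (nat \<Rightarrow> nat) \<Rightarrow> 'a" where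
  "monomial G xs k v = (\<Otimes>\<^bsub>G\<^esub>i\<in>{..<k}. xs i [^]\<^bsub>G\<^esub> v i)"

context comm_group
begin

lemma monomial_closed:
  assumes "\<And>i. xs i \<in> carrier G"
  shows "monomial G xs k v \<in> carrier G"
  unfolding monomial_def using assms by (intro finprod_closed) auto

lemma monomial_add:
  assumes "\<And>i. xs i \<in> carrier G"
  shows "monomial G xs k (\<lambda>i. v i + w i) = monomial G xs k v \<otimes> monomial G xs k w"
proof -
  have "monomial G xs k v \<otimes> monomial G xs k w = (\<Otimes>i\<in>{..<k}. xs i [^] v i \<otimes> xs i [^] w i)"
    unfolding monomial_def using assms by (intro finprod_multf[symmetric]) auto
  also have "\<dots> = monomial G xs k (\<lambda>i. v i + w i)"
    unfolding monomial_def using assms by (intro finprod_cong) (auto simp: nat_pow_mult)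
  finally show ?thesis ..
qed

lemma monomial_scale:
  assumes "\<And>i. xs i \<in> carrier G"
  shows "monomial G xs k (\<lambda>i. c * v i) = monomial G xs k v [^] c"
proof (induction c)
  case 0
  then show ?case by (simp add: monomial_def)
next
  case (Suc c)
  have "monomial G xs k (\<lambda>i. Suc c * v i) = monomial G xs k (\<lambda>i. c * v i + v i)"
    by (simp add: algebra_simps)
  then show ?case using Suc monomial_add[OF assms, where k = k and v = "\<lambda>i. c * v i" and w = v] by simp
qed

lemma monomial_cong:
  assumes "\<And>i. xs i \<in> carrier G" "\<And>i. xs i [^] (p::nat) = \<one>" "\<And>i. i < k \<Longrightarrow> [v i = w i] (mod p)"
  shows "monomial G xs k v = monomial G xs k w"
  unfolding monomial_def using assms
  by (intro finprod_cong) (auto simp: simp_implies_def intro!: pow_cong_exponent[of _ p])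

lemma monomial_Suc:
  assumes "\<And>i. xs i \<in> carrier G"
  shows "monomial G xs (Suc k) v = xs k [^] v k \<otimes> monomial G xs k v"
  unfolding monomial_def lessThan_Suc using assms by (subst finprod_insert) auto

text \<open>
  This is the extension of a linearly independent family.  A family of \<open>k < n\<close> elements spans at most
  \<open>p ^ k\<close> elements, so some \<open>x\<close> lies outside the span.  If adding \<open>x\<close> destroyed independence, some
  power of \<open>x\<close> with exponent prime to \<open>p\<close> would lie in the span, and hence so would \<open>x\<close>.
\<close>

lemma independent_generators:
  assumes p: "prime (p::nat)" and exp: "\<And>x. x \<in> carrier G \<Longrightarrow> x [^] p = \<one>"
    and ord: "order G = p ^ n" and "k \<le> n"
  shows "\<exists>xs. (\<forall>i. xs i \<in> carrier G) \<and> inj_on (monomial G xs k) ({..<k} \<rightarrow>\<^sub>E {..<p})"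
  using \<open>k \<le> n\<close>
proof (induction k)
  case 0
  show ?case by (intro exI[of _ "\<lambda>_. \<one>"]) auto
next
  case (Suc k)
  then obtain xs where xs: "\<And>i. xs i \<in> carrier G"
    and inj: "inj_on (monomial G xs k) ({..<k} \<rightarrow>\<^sub>E {..<p})" by auto
  have p1: "p > 1" using p prime_gt_1_nat by auto
  define I where "I = monomial G xs k ` ({..<k} \<rightarrow>\<^sub>E {..<p})"
  have memI: "monomial G xs k v \<in> I" for v
  proof -
    have "monomial G xs k v = monomial G xs k (\<lambda>i\<in>{..<k}. v i mod p)"
      by (rule monomial_cong) (use xs exp in \<open>auto simp: cong_def\<close>)
    then show ?thesis unfolding I_def using p1 by (auto intro!: imageI)
  qed
  have "card I \<le> p ^ k"
    using card_image_le[of "{..<k} \<rightarrow>\<^sub>E {..<p}" "monomial G xs k"]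
    by (simp add: I_def card_PiE finite_PiE)
  also have "\<dots> < card (carrier G)"
    using ord Suc.prems p1 by (simp add: order_def)
  finally obtain x where x: "x \<in> carrier G" "x \<notin> I"
    by (metis I_def card_mono finite_PiE finite_imageI finite_lessThan leD subsetI)
  define ys where "ys = xs(k := x)"
  have ys: "ys i \<in> carrier G" for i using xs x by (simp add: ys_def)
  have ysk: "monomial G ys k v = monomial G xs k v" for v
    unfolding monomial_def ys_def using xs by (intro finprod_cong) auto
  have key: "a = b" if "x [^] a \<otimes> monomial G xs k v = x [^] b \<otimes> monomial G xs k w" "a < p" "b < p"
    for a b v w
  proof (rule ccontr)
    assume "a \<noteq> b"
    \<comment> \<open>Natural number exponents: multiplication by \<open>p - 1\<close> replaces negation, so \<open>?m\<close> stands for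
        \<open>a - b\<close> and \<open>?u\<close> for \<open>w - v\<close>.\<close>
    let ?m = "a + (p - 1) * b" and ?u = "\<lambda>i. w i + (p - 1) * v i"
    have inv1: "y \<otimes> y [^] (p - 1) = \<one>" if "y \<in> carrier G" for y
      using exp[OF that] p1 that nat_pow_Suc2[of y "p - 1"] by simp
    have "\<not> p dvd ?m"
    proof
      assume "p dvd ?m"
      then have "[int a + (int p - 1) * int b = 0] (mod int p)"
        using p1 by (simp add: cong_0_iff of_nat_diff flip: int_dvd_int_iff)
      then have "int p dvd (int a - int b) + int p * int b"
        by (simp add: cong_0_iff algebra_simps)
      then have "int p dvd int a - int b" by (simp add: dvd_add_left_iff)
      then show False using \<open>a \<noteq> b\<close> that(2,3)
        by (smt (verit) zdvd_not_zless of_nat_0_le_iff of_nat_eq_iff of_nat_less_iff zdvd_zdiffD dvd_minus_iff)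
    qed
    then have "coprime ?m p" using p by (metis coprime_commute prime_imp_coprime)
    then obtain c where c: "[?m * c = 1] (mod p)" using cong_solve_coprime_nat by auto
    let ?V = "monomial G xs k v" and ?W = "monomial G xs k w"
    have cl: "?V \<in> carrier G" "?W \<in> carrier G" by (rule monomial_closed[OF xs])+
    have "x [^] ?m = x [^] a \<otimes> (x [^] b) [^] (p - 1)"
      using x by (simp add: nat_pow_mult nat_pow_pow mult.commute)
    also have "\<dots> = x [^] a \<otimes> (?V \<otimes> ?V [^] (p - 1)) \<otimes> (x [^] b) [^] (p - 1)"
      using inv1 cl x by simp
    also have "\<dots> = (x [^] a \<otimes> ?V) \<otimes> (?V [^] (p - 1) \<otimes> (x [^] b) [^] (p - 1))"
      using cl x by (simp add: m_ac)
    also have "\<dots> = (x [^] b \<otimes> ?W) \<otimes> (?V [^] (p - 1) \<otimes> (x [^] b) [^] (p - 1))"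
      using that by simp
    also have "\<dots> = (x [^] b \<otimes> (x [^] b) [^] (p - 1)) \<otimes> (?W \<otimes> ?V [^] (p - 1))"
      using cl x by (simp add: m_ac)
    also have "\<dots> = monomial G xs k ?u"
      using inv1[of "x [^] b"] cl x monomial_add[OF xs] monomial_scale[OF xs] by simp
    finally have "x [^] ?m = monomial G xs k ?u" .
    then have "x [^] (?m * c) = monomial G xs k (\<lambda>i. c * ?u i)"
      using x monomial_scale[OF xs, where k = k and c = c and v = ?u] by (simp flip: nat_pow_pow)
    moreover have "x [^] (?m * c) = x [^] (1::nat)"
      using x exp c by (intro pow_cong_exponent) auto
    ultimately show False using x memI[of "\<lambda>i. c * ?u i"] by simp
  qed
  have "inj_on (monomial G ys (Suc k)) ({..<Suc k} \<rightarrow>\<^sub>E {..<p})"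
  proof (rule inj_onI)
    fix v w assume vw: "v \<in> {..<Suc k} \<rightarrow>\<^sub>E {..<p}" "w \<in> {..<Suc k} \<rightarrow>\<^sub>E {..<p}"
      and "monomial G ys (Suc k) v = monomial G ys (Suc k) w"
    then have eq: "x [^] v k \<otimes> monomial G xs k v = x [^] w k \<otimes> monomial G xs k w"
      by (simp add: monomial_Suc[OF ys] ysk) (simp add: ys_def)
    have vk: "v k < p" "w k < p" using PiE_mem[OF vw(1), of k] PiE_mem[OF vw(2), of k] by auto
    then have "v k = w k" using key eq by blast
    with eq have "monomial G xs k v = monomial G xs k w"
      using x monomial_closed[OF xs] by simp
    moreover have "monomial G xs k u = monomial G xs k (restrict u {..<k})" for u
      unfolding monomial_def using xs by (intro finprod_cong) auto
    ultimately have "monomial G xs k (restrict v {..<k}) = monomial G xs k (restrict w {..<k})"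
      by metis
    moreover have "restrict v {..<k} \<in> {..<k} \<rightarrow>\<^sub>E {..<p}" "restrict w {..<k} \<in> {..<k} \<rightarrow>\<^sub>E {..<p}"
      using vw by (auto simp: PiE_iff)
    ultimately have r: "restrict v {..<k} = restrict w {..<k}" by (rule inj_onD[OF inj])
    show "v = w"
    proof (rule PiE_ext[OF vw])
      fix i assume "i \<in> {..<Suc k}"
      then show "v i = w i" using \<open>v k = w k\<close> fun_cong[OF r, of i] by (cases "i = k") auto
    qed
  qed
  then show ?case using ys by blast
qed

lemma bij_monomial:
  assumes p: "prime (p::nat)" and exp: "\<And>x. x \<in> carrier G \<Longrightarrow> x [^] p = \<one>"
    and ord: "order G = p ^ n"
  obtains xs where "\<And>i. xs i \<in> carrier G"
    "bij_betw (monomial G xs n) ({..<n} \<rightarrow>\<^sub>E {..<p}) (carrier G)"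
proof -
  obtain xs where xs: "\<And>i. xs i \<in> carrier G"
    and inj: "inj_on (monomial G xs n) ({..<n} \<rightarrow>\<^sub>E {..<p})"
    using independent_generators[OF assms order_refl] by blast
  have "card (carrier G) = p ^ n" using ord by (simp add: order_def)
  moreover have "finite (carrier G)"
    using calculation prime_gt_0_nat[OF p] by (intro card_ge_0_finite) simp
  ultimately have "monomial G xs n ` ({..<n} \<rightarrow>\<^sub>E {..<p}) = carrier G"
    using monomial_closed[OF xs] by (intro card_subset_eq) (auto simp: card_image[OF inj] card_PiE)
  with inj xs that show ?thesis by (auto simp: bij_betw_def)
qed

end

lemma elementary_abelian_exponent:
  assumes "elementary_abelian p n G" "x \<in> carrier G"
  shows "x [^]\<^bsub>G\<^esub> p = \<one>\<^bsub>G\<^esub>"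
proof -
  interpret comm_group G using assms by (simp add: elementary_abelian_def)
  show ?thesis
    using assms by (cases "x = \<one>\<^bsub>G\<^esub>") (auto simp: elementary_abelian_def pow_eq_id)
qed

lemma elementary_abelianI:
  assumes "comm_group G" "prime p" "order G = p ^ n" "\<And>x. x \<in> carrier G \<Longrightarrow> x [^]\<^bsub>G\<^esub> p = \<one>\<^bsub>G\<^esub>"
  shows "elementary_abelian p n G"
proof -
  interpret comm_group G by fact
  have "ord x = p" if "x \<in> carrier G" "x \<noteq> \<one>\<^bsub>G\<^esub>" for x
    using that assms(2) assms(4)[of x] ord_eq_1[of x] by (auto simp: pow_eq_id prime_nat_iff)
  then show ?thesis using assms by (auto simp: elementary_abelian_def)
qed

text \<open>
  Both groups have a basis of \<open>n\<close> elements; the isomorphism reads off the exponents with respect to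
  the first basis and uses them in the second.
\<close>

theorem elementary_abelian_unique:
  assumes p: "prime p" and G: "elementary_abelian p n G" and H: "elementary_abelian p n H"
  shows "G \<cong> H"
proof -
  interpret G: comm_group G using G by (simp add: elementary_abelian_def)
  interpret H: comm_group H using H by (simp add: elementary_abelian_def)
  let ?P = "{..<n} \<rightarrow>\<^sub>E {..<p}"
  obtain xs where xs: "\<And>i. xs i \<in> carrier G" and bG: "bij_betw (monomial G xs n) ?P (carrier G)"
    using G.bij_monomial[OF p elementary_abelian_exponent[OF G]] G
    by (auto simp: elementary_abelian_def)
  obtain ys where ys: "\<And>i. ys i \<in> carrier H" and bH: "bij_betw (monomial H ys n) ?P (carrier H)"
    using H.bij_monomial[OF p elementary_abelian_exponent[OF H]] H
    by (auto simp: elementary_abelian_def)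
  define r where "r = inv_into ?P (monomial G xs n)"
  have r: "r g \<in> ?P" "monomial G xs n (r g) = g" if "g \<in> carrier G" for g
    using bG that unfolding r_def by (auto simp: bij_betw_def inv_into_into f_inv_into_f)
  have "bij_betw (monomial H ys n \<circ> r) (carrier G) (carrier H)"
    unfolding r_def using bij_betw_inv_into[OF bG] bH by (rule bij_betw_trans)
  moreover have "monomial H ys n \<circ> r \<in> hom G H"
  proof (rule homI)
    fix g g' assume g: "g \<in> carrier G" "g' \<in> carrier G"
    define s where "s = (\<lambda>i\<in>{..<n}. (r g i + r g' i) mod p)"
    have sP: "s \<in> ?P" using prime_gt_0_nat[OF p] by (auto simp: s_def)
    have cong: "[s i = r g i + r g' i] (mod p)" if "i < n" for i using that by (simp add: s_def)
    have "monomial G xs n s = monomial G xs n (\<lambda>i. r g i + r g' i)"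
      using xs elementary_abelian_exponent[OF G xs] cong by (rule G.monomial_cong)
    also have "\<dots> = g \<otimes>\<^bsub>G\<^esub> g'" using G.monomial_add[OF xs] r g by simp
    finally have "r (g \<otimes>\<^bsub>G\<^esub> g') = s"
      using bG sP unfolding r_def by (metis bij_betw_def inv_into_f_f)
    moreover have "monomial H ys n s = monomial H ys n (\<lambda>i. r g i + r g' i)"
      using ys elementary_abelian_exponent[OF H ys] cong by (rule H.monomial_cong)
    ultimately show "(monomial H ys n \<circ> r) (g \<otimes>\<^bsub>G\<^esub> g')
        = (monomial H ys n \<circ> r) g \<otimes>\<^bsub>H\<^esub> (monomial H ys n \<circ> r) g'"
      using H.monomial_add[OF ys] by simp
  qed (use H.monomial_closed[OF ys] in auto)
  ultimately show ?thesis by (auto simp: is_iso_def iso_def)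
qed

text \<open>
  If another prime \<open>q\<close> divided the order, a subgroup of order \<open>q\<close> would exist by Sylow, and the order of
  a nontrivial element of it would divide both \<open>q\<close> and a power of \<open>p\<close>.
\<close>

lemma p_groupI_exponent:
  assumes "group G" "finite (carrier G)" "prime p"
    and exp: "\<And>x. x \<in> carrier G \<Longrightarrow> x [^]\<^bsub>G\<^esub> (p ^ e) = \<one>\<^bsub>G\<^esub>"
  shows "p_group p G"
proof -
  interpret group G by fact
  have q: "q = p" if q: "prime q" "q dvd order G" for q
  proof (rule ccontr)
    assume "q \<noteq> p"
    obtain m where "order G = q ^ 1 * m" using q(2) by (auto elim: dvdE)
    then obtain Q where Q: "subgroup Q G" "card Q = q"
      using sylow_thm[OF q(1) assms(1) _ assms(2), of 1 m] by (metis power_one_right)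
    then interpret Q: group "G\<lparr>carrier := Q\<rparr>" by (simp add: subgroup.subgroup_is_group)
    have "Q \<noteq> {\<one>\<^bsub>G\<^esub>}" using Q(2) q(1) by auto
    then obtain x where x: "x \<in> Q" "x \<noteq> \<one>\<^bsub>G\<^esub>" using subgroup.one_closed[OF Q(1)] by blast
    have xG: "x \<in> carrier G" using x Q subgroup.mem_carrier by metis
    have "x [^]\<^bsub>G\<^esub> q = \<one>\<^bsub>G\<^esub>"
      using Q.pow_order_eq_1[of x] x Q by (simp add: order_def flip: nat_pow_consistent)
    then have "ord x dvd q" "ord x dvd p ^ e" using exp xG by (auto simp: pow_eq_id)
    moreover have "coprime q (p ^ e)"
      using q(1) \<open>prime p\<close> \<open>q \<noteq> p\<close> by (simp add: primes_coprime)
    ultimately have "ord x = 1" by (metis coprime_common_divisor_nat)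
    then show False using x xG ord_eq_1 by blast
  qed
  have "order G \<noteq> 0" using assms(2) by (simp add: order_gt_0_iff_finite)
  then obtain m where m: "order G = p ^ multiplicity p (order G) * m" "\<not> p dvd m"
    using multiplicity_decompose'[of "order G" p] assms(3) by (metis not_prime_unit)
  have "m = 1"
  proof (rule ccontr)
    assume "m \<noteq> 1"
    then obtain r where "prime r" "r dvd m" using prime_factor_nat by blast
    then show False using q[of r] m by (metis dvd_mult)
  qed
  then have "order G = p ^ multiplicity p (order G)" using m(1) by simp
  then show ?thesis using assms(1) unfolding p_group_def by blast
qed

section \<open>Permutation groups\<close>

lemma perm_mult:
  assumes "f \<in> Bij \<Omega>" "g \<in> Bij \<Omega>"
  shows "f \<otimes>\<^bsub>BijGroup \<Omega>\<^esub> g = compose \<Omega> f g"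
  using assms by (simp add: BijGroup_def)

text \<open>
  Left inverses within \<open>S\<close> suffice: the left inverse of a left inverse of \<open>g\<close> shows that \<open>g\<close> is
  bijective.
\<close>

lemma subgroup_BijGroupI:
  assumes ext: "\<And>g. g \<in> S \<Longrightarrow> g \<in> \<Omega> \<rightarrow>\<^sub>E \<Omega>"
    and one: "(\<lambda>x\<in>\<Omega>. x) \<in> S"
    and comp: "\<And>f g. f \<in> S \<Longrightarrow> g \<in> S \<Longrightarrow> compose \<Omega> f g \<in> S"
    and inv: "\<And>g. g \<in> S \<Longrightarrow> \<exists>g'\<in>S. compose \<Omega> g' g = (\<lambda>x\<in>\<Omega>. x)"
  shows "subgroup S (BijGroup \<Omega>)"
proof -
  have left: "\<exists>g'\<in>S. \<forall>x\<in>\<Omega>. g' (g x) = x" if "g \<in> S" for g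
    using inv[OF that] by (metis compose_eq restrict_apply')
  have S: "S \<subseteq> Bij \<Omega>"
  proof
    fix g assume "g \<in> S"
    then obtain g' where g': "g' \<in> S" "\<And>x. x \<in> \<Omega> \<Longrightarrow> g' (g x) = x" using left by blast
    then obtain g'' where g'': "g'' \<in> S" "\<And>x. x \<in> \<Omega> \<Longrightarrow> g'' (g' x) = x" using left by blast
    have "g (g' x) = x" if "x \<in> \<Omega>" for x
      by (metis PiE_mem \<open>g \<in> S\<close> ext g' g'' that)
    then have "bij_betw g \<Omega> \<Omega>"
      using ext[OF \<open>g \<in> S\<close>] ext[OF g'(1)] g'(2) by (intro bij_betw_byWitness[of _ g']) auto
    then show "g \<in> Bij \<Omega>" using ext[OF \<open>g \<in> S\<close>] by (auto simp: Bij_def PiE_def)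
  qed
  interpret group "BijGroup \<Omega>" by (rule group_BijGroup)
  show ?thesis
  proof (rule subgroupI)
    fix g assume g: "g \<in> S"
    then obtain g' where g': "g' \<in> S" "compose \<Omega> g' g = (\<lambda>x\<in>\<Omega>. x)" using inv by blast
    have "inv\<^bsub>BijGroup \<Omega>\<^esub> g = g'"
      using g g' S by (intro inv_equality) (auto simp: BijGroup_def)
    then show "inv\<^bsub>BijGroup \<Omega>\<^esub> g \<in> S" using g' by simp
  qed (use S one comp in \<open>auto simp: BijGroup_def subset_iff\<close>)
qed

context
  fixes \<Omega> :: "'a set" and \<Gamma> :: "('a \<Rightarrow> 'a) set"
  assumes \<Gamma>: "subgroup \<Gamma> (BijGroup \<Omega>)"
begin

lemma perm_group_group: "group (perm_group \<Omega> \<Gamma>)"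
  using \<Gamma> group_BijGroup by (rule subgroup.subgroup_is_group)

lemma perm_group_Bij: "g \<in> \<Gamma> \<Longrightarrow> g \<in> Bij \<Omega>"
  using subgroup.mem_carrier[OF \<Gamma>] by (simp add: BijGroup_def)

lemma perm_group_closed: "g \<in> \<Gamma> \<Longrightarrow> x \<in> \<Omega> \<Longrightarrow> g x \<in> \<Omega>"
  using perm_group_Bij Bij_imp_funcset by blast

lemma perm_group_ext: "g \<in> \<Gamma> \<Longrightarrow> f \<in> \<Gamma> \<Longrightarrow> (\<And>x. x \<in> \<Omega> \<Longrightarrow> g x = f x) \<Longrightarrow> g = f"
  using perm_group_Bij Bij_imp_extensional extensionalityI by metis

lemma perm_group_one: "\<one>\<^bsub>perm_group \<Omega> \<Gamma>\<^esub> = (\<lambda>x\<in>\<Omega>. x)"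
  by (simp add: BijGroup_def)

lemma perm_group_mult:
  "f \<in> \<Gamma> \<Longrightarrow> g \<in> \<Gamma> \<Longrightarrow> f \<otimes>\<^bsub>perm_group \<Omega> \<Gamma>\<^esub> g = compose \<Omega> f g"
  by (simp add: perm_mult perm_group_Bij)

lemma perm_group_pow:
  assumes "g \<in> \<Gamma>" "x \<in> \<Omega>"
  shows "(g [^]\<^bsub>perm_group \<Omega> \<Gamma>\<^esub> (n::nat)) x = (g ^^ n) x"
  using assms(2)
proof (induction n arbitrary: x)
  case 0
  then show ?case by (simp add: BijGroup_def nat_pow_def)
next
  case (Suc n)
  interpret group "perm_group \<Omega> \<Gamma>" by (rule perm_group_group)
  have "g [^]\<^bsub>perm_group \<Omega> \<Gamma>\<^esub> n \<in> \<Gamma>" using nat_pow_closed[of g n] assms(1) by simp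
  then have "(g [^]\<^bsub>perm_group \<Omega> \<Gamma>\<^esub> Suc n) x = (g [^]\<^bsub>perm_group \<Omega> \<Gamma>\<^esub> n) (g x)"
    using assms(1) Suc.prems by (simp add: perm_mult perm_group_Bij compose_eq)
  then show ?case using Suc perm_group_closed[OF assms(1)] by (simp add: funpow_swap1)
qed

lemma perm_group_pow_eq_one:
  assumes "g \<in> \<Gamma>" "\<And>x. x \<in> \<Omega> \<Longrightarrow> (g ^^ n) x = x"
  shows "g [^]\<^bsub>perm_group \<Omega> \<Gamma>\<^esub> (n::nat) = \<one>\<^bsub>perm_group \<Omega> \<Gamma>\<^esub>"
proof -
  interpret group "perm_group \<Omega> \<Gamma>" by (rule perm_group_group)
  have "g [^]\<^bsub>perm_group \<Omega> \<Gamma>\<^esub> n \<in> \<Gamma>" using nat_pow_closed[of g n] assms(1) by simp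
  moreover have "\<one>\<^bsub>perm_group \<Omega> \<Gamma>\<^esub> \<in> \<Gamma>" using one_closed by simp
  ultimately show ?thesis
    by (rule perm_group_ext) (use assms in \<open>simp add: perm_group_pow perm_group_one del: monoid.simps\<close>)
qed

lemma transitive_perm_groupI:
  assumes "\<And>x y. x \<in> \<Omega> \<Longrightarrow> y \<in> \<Omega> \<Longrightarrow> \<exists>g\<in>\<Gamma>. g x = y"
  shows "transitive_perm_group \<Omega> \<Gamma>"
proof -
  have "group_hom (perm_group \<Omega> \<Gamma>) (BijGroup \<Omega>) (\<lambda>g. g)"
    using group.canonical_inj_is_hom[OF group_BijGroup \<Gamma>] by (simp add: id_def)
  then have "group_action (perm_group \<Omega> \<Gamma>) \<Omega> (\<lambda>g. g)"
    by (rule group_action.intro)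
  moreover have "transitive_action_axioms (perm_group \<Omega> \<Gamma>) \<Omega> (\<lambda>g. g)"
    using assms by (simp add: transitive_action_axioms_def)
  ultimately have "transitive_action (perm_group \<Omega> \<Gamma>) \<Omega> (\<lambda>g. g)"
    by (rule transitive_action.intro)
  with \<Gamma> show ?thesis by (simp add: transitive_perm_group_def)
qed

lemma regular_perm_groupI:
  assumes "\<And>x y. x \<in> \<Omega> \<Longrightarrow> y \<in> \<Omega> \<Longrightarrow> \<exists>g\<in>\<Gamma>. g x = y"
    and "\<And>g x y. g \<in> \<Gamma> \<Longrightarrow> x \<in> \<Omega> \<Longrightarrow> g x = x \<Longrightarrow> y \<in> \<Omega> \<Longrightarrow> g y = y"
  shows "regular_perm_group \<Omega> \<Gamma>"
proof -
  have "stabilizer (perm_group \<Omega> \<Gamma>) (\<lambda>g. g) x = {\<one>\<^bsub>perm_group \<Omega> \<Gamma>\<^esub>}" if "x \<in> \<Omega>" for x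
  proof -
    have one: "(\<lambda>x\<in>\<Omega>. x) \<in> \<Gamma>" using subgroup.one_closed[OF \<Gamma>] by (simp add: BijGroup_def)
    have "g = (\<lambda>x\<in>\<Omega>. x)" if "g \<in> \<Gamma>" "g x = x" for g
      using that(1) one
    proof (rule perm_group_ext)
      fix y assume "y \<in> \<Omega>"
      then show "g y = (\<lambda>x\<in>\<Omega>. x) y"
        using assms(2)[OF that(1) \<open>x \<in> \<Omega>\<close> that(2)] by simp
    qed
    moreover have "(\<lambda>x\<in>\<Omega>. x) x = x" using \<open>x \<in> \<Omega>\<close> by simp
    ultimately have "{g \<in> \<Gamma>. g x = x} = {\<lambda>x\<in>\<Omega>. x}"
      using one by blast
    then show ?thesis by (simp add: stabilizer_def BijGroup_def)
  qed
  then show ?thesis using transitive_perm_groupI assms(1) by (auto simp: regular_perm_group_def)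
qed

end

lemma order_regular_perm_group:
  assumes reg: "regular_perm_group \<Omega> R" and "\<Omega> \<noteq> {}"
  shows "order (perm_group \<Omega> R) = card \<Omega>"
proof -
  obtain w where w: "w \<in> \<Omega>" using assms(2) by blast
  have R: "subgroup R (BijGroup \<Omega>)" and tr: "transitive_action (perm_group \<Omega> R) \<Omega> (\<lambda>g. g)"
    using reg by (auto simp: regular_perm_group_def transitive_perm_group_def)
  interpret A: transitive_action "perm_group \<Omega> R" \<Omega> "\<lambda>g. g" by (rule tr)
  interpret group "perm_group \<Omega> R" by (rule perm_group_group[OF R])
  have "orbit (perm_group \<Omega> R) (\<lambda>g. g) w = \<Omega>"
    using A.unique_orbit[OF w] perm_group_closed[OF R _ w]
    by (auto simp: orbit_def) 
  moreover have "stabilizer (perm_group \<Omega> R) (\<lambda>g. g) w = {\<one>\<^bsub>perm_group \<Omega> R\<^esub>}"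
    using reg w by (auto simp: regular_perm_group_def)
  ultimately show ?thesis
    using A.orbit_stabilizer_theorem[OF w] by simp
qed

section \<open>Iterated finite differences\<close>

primrec fdiff :: "nat \<Rightarrow> (nat \<Rightarrow> int) \<Rightarrow> nat \<Rightarrow> int" where
  "fdiff 0 u = u"
| "fdiff (Suc n) u = fdiff n (\<lambda>x. u (Suc x) - u x)"

lemma fdiff_sum: "fdiff n (\<lambda>x. \<Sum>k\<in>A. u k x) x = (\<Sum>k\<in>A. fdiff n (u k) x)"
  by (induction n arbitrary: u) (simp_all flip: sum_subtractf)

lemma fdiff_diff: "fdiff n (\<lambda>x. u x - v x) x = fdiff n u x - fdiff n v x"
proof (induction n arbitrary: u v)
  case (Suc n)
  have "fdiff (Suc n) (\<lambda>x. u x - v x) x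
      = fdiff n (\<lambda>x. (u (Suc x) - u x) - (v (Suc x) - v x)) x"
    by (simp add: algebra_simps)
  then show ?case by (simp only: Suc fdiff.simps)
qed simp

lemma fdiff_mult_right: "fdiff n (\<lambda>x. u x * c) x = fdiff n u x * c"
  by (induction n arbitrary: u) (simp_all flip: left_diff_distrib)

lemma fdiff_shift: "fdiff n (\<lambda>x. u (x + a)) x = fdiff n u (x + a)"
  by (induction n arbitrary: u) simp_all

lemma fdiff_dvd: "(\<And>x. m dvd u x) \<Longrightarrow> m dvd fdiff n u x"
  by (induction n arbitrary: u) simp_all

lemma fdiff_const: "fdiff (Suc n) (\<lambda>x. c) x = 0"
  using fdiff_dvd[of 0 "\<lambda>x. 0" n x] by simp

lemma fdiff_choose:
  "fdiff n (\<lambda>x. int (x choose k)) x = (if n \<le> k then int (x choose (k - n)) else 0)"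
proof (induction n arbitrary: k)
  case (Suc n)
  show ?case
  proof (cases k)
    case 0
    then show ?thesis using fdiff_const[of n 1 x] by simp
  next
    case (Suc k')
    then show ?thesis using Suc.IH[of k'] by simp
  qed
qed simp

definition mixed_diff :: "nat \<Rightarrow> nat \<Rightarrow> (nat \<Rightarrow> nat \<Rightarrow> int) \<Rightarrow> nat \<Rightarrow> nat \<Rightarrow> int" where
  "mixed_diff i j f x y = fdiff j (\<lambda>y'. fdiff i (\<lambda>x'. f x' y') x) y"

lemma mixed_diff_sum:
  "mixed_diff i j (\<lambda>x y. \<Sum>k\<in>A. f k x y) x y = (\<Sum>k\<in>A. mixed_diff i j (f k) x y)"
  by (simp add: mixed_diff_def fdiff_sum)

lemma mixed_diff_diff:
  "mixed_diff i j (\<lambda>x y. f x y - g x y) x y = mixed_diff i j f x y - mixed_diff i j g x y"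
  by (simp add: mixed_diff_def fdiff_diff)

lemma mixed_diff_add:
  "mixed_diff i j (\<lambda>x y. f x y + g x y) x y = mixed_diff i j f x y + mixed_diff i j g x y"
  using mixed_diff_diff[of i j "\<lambda>x y. f x y + g x y" g x y] by simp

lemma mixed_diff_shift:
  "mixed_diff i j (\<lambda>x y. f (x + a) (y + b)) x y = mixed_diff i j f (x + a) (y + b)"
  unfolding mixed_diff_def
  using fdiff_shift[of j "\<lambda>y'. fdiff i (\<lambda>x'. f x' y') (x + a)" b y]
  by (simp add: fdiff_shift[where u = "\<lambda>x'. f x' y'" for y'])

lemma mixed_diff_dvd: "(\<And>x y. m dvd f x y) \<Longrightarrow> m dvd mixed_diff i j f x y"
  by (simp add: mixed_diff_def fdiff_dvd)

lemma mixed_diff_prod: "mixed_diff i j (\<lambda>x y. u x * v y) x y = fdiff i u x * fdiff j v y"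
  by (simp add: mixed_diff_def fdiff_mult_right mult.commute[of "fdiff i u x"])

lemma mixed_diff_const:
  assumes "i + j > 0"
  shows "mixed_diff i j (\<lambda>x y. c) x y = 0"
  using assms mixed_diff_prod[of i j "\<lambda>x. c" "\<lambda>x. 1" x y] fdiff_const
  by (cases i; cases j) (auto simp del: fdiff.simps)

text \<open>
  If one difference in \<open>x\<close> makes \<open>u\<close> constant modulo \<open>m\<close>, a further difference in \<open>y\<close> makes it vanish.
\<close>

lemma mixed_diff_dvd_of_const_step:
  assumes "\<And>x y. m dvd u (Suc x) y - u x y - c"
  shows "m dvd mixed_diff (Suc i) (Suc j) u x y"
proof -
  have "mixed_diff (Suc i) (Suc j) u x y
      = mixed_diff i (Suc j) (\<lambda>x y. (u (Suc x) y - u x y - c) + c) x y"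
    by (simp add: mixed_diff_def)
  also have "\<dots> = mixed_diff i (Suc j) (\<lambda>x y. u (Suc x) y - u x y - c) x y"
    by (subst mixed_diff_add) (simp add: mixed_diff_const)
  finally show ?thesis using mixed_diff_dvd[OF assms] by simp
qed

text \<open>
  The bound on \<open>k\<close> is sharp: \<open>(p choose p) = 1\<close> although \<open>(0 choose p) = 0\<close>.  Below it, \<open>p\<close> divides
  \<open>(p choose k)\<close> for \<open>k > 0\<close>, and Pascal's rule carries the period \<open>p\<close> from one argument to the next.
\<close>

lemma choose_mod_prime_periodic:
  assumes p: "prime p" and "k < p" "[x = y] (mod p)"
  shows "[x choose k = y choose k] (mod p)"
proof -
  have step: "[(x + p) choose k = x choose k] (mod p)" if "k < p" for x k
    using that
  proof (induction x arbitrary: k)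
    case 0
    show ?case
    proof (cases k)
      case (Suc k')
      then show ?thesis using dvd_choose_prime[of k p] 0 p by (simp add: cong_0_iff)
    qed simp
  next
    case (Suc x)
    then show ?case by (cases k) (auto intro!: cong_add)
  qed
  have "[(x + n * p) choose k = x choose k] (mod p)" for x n
  proof (induction n)
    case (Suc n)
    have "x + Suc n * p = (x + n * p) + p" by simp
    then show ?case using cong_trans[OF step[OF \<open>k < p\<close>, of "x + n * p"] Suc] by metis
  qed simp
  from this[of "x mod p" "x div p"] this[of "y mod p" "y div p"] show ?thesis
    using assms(3) by (simp add: cong_def)
qed

section \<open>Shears of the cube\<close>

locale prime_cube =
  fixes p :: nat
  assumes prime_p: "prime p"
begin

lemma p_gt_1: "p > 1" using prime_p prime_gt_1_nat by blast

definition \<Omega> :: "nat set" where "\<Omega> = {..<p ^ 3}"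

definition cX :: "nat \<Rightarrow> nat" where "cX w = w mod p"
definition cY :: "nat \<Rightarrow> nat" where "cY w = w div p mod p"
definition cZ :: "nat \<Rightarrow> nat" where "cZ w = w div p div p"

text \<open>
  The coordinates may be arbitrary numbers and are reduced modulo \<open>p\<close> here, so that all computations
  with points become congruences (lemma \<open>point_eq_iff\<close>).
\<close>

definition point :: "nat \<Rightarrow> nat \<Rightarrow> int \<Rightarrow> nat" where
  "point x y z = x mod p + p * (y mod p + p * nat (z mod int p))"

lemma coords_point:
  "cX (point x y z) = x mod p" "cY (point x y z) = y mod p" "int (cZ (point x y z)) = z mod int p"
  using p_gt_1 by (simp_all add: cX_def cY_def cZ_def point_def)

lemma point_in: "point x y z \<in> \<Omega>"
proof -
  have less: "a + p * b < p * m" if "a < p" "b < m" for a b m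
  proof -
    have "a + p * b < p * Suc b" using that by simp
    also have "\<dots> \<le> p * m" using that by (intro mult_left_mono) auto
    finally show ?thesis .
  qed
  have "nat (z mod int p) < p" using p_gt_1 by (simp add: nat_less_iff)
  then have "point x y z < p * (p * p)"
    unfolding point_def using p_gt_1 by (intro less) auto
  then show ?thesis by (simp add: \<Omega>_def power3_eq_cube mult.assoc)
qed

lemma point_coords: "w \<in> \<Omega> \<Longrightarrow> point (cX w) (cY w) (int (cZ w)) = w"
proof -
  assume "w \<in> \<Omega>"
  then have "w div p div p < p"
    by (simp add: \<Omega>_def power3_eq_cube less_mult_imp_div_less)
  then show ?thesis by (simp add: point_def cX_def cY_def cZ_def flip: zmod_int)
qed

lemma point_eq_iff:
  "point x y z = point x' y' z' \<longleftrightarrow> [x = x'] (mod p) \<and> [y = y'] (mod p) \<and> [z = z'] (mod int p)"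
  by (metis coords_point cong_def point_def)

lemma point_cases:
  assumes "w \<in> \<Omega>" obtains x y z where "w = point x y z"
  using point_coords[OF assms] by metis

text \<open>
  Functions on pairs of residues with values in the residues modulo \<open>p\<close> are represented by integer
  valued functions on pairs of natural numbers that respect congruence.
\<close>

definition periodic :: "(nat \<Rightarrow> nat \<Rightarrow> int) \<Rightarrow> bool" where
  "periodic f \<longleftrightarrow> (\<forall>x x' y y'. [x = x'] (mod p) \<longrightarrow> [y = y'] (mod p) \<longrightarrow> [f x y = f x' y'] (mod int p))"

lemma periodicD:
  "periodic f \<Longrightarrow> [x = x'] (mod p) \<Longrightarrow> [y = y'] (mod p) \<Longrightarrow> [f x y = f x' y'] (mod int p)"
  by (auto simp: periodic_def)

lemma periodic_const: "periodic (\<lambda>x y. c)"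
  by (simp add: periodic_def)

lemma periodic_add: "periodic f \<Longrightarrow> periodic g \<Longrightarrow> periodic (\<lambda>x y. f x y + g x y)"
  by (simp add: periodic_def cong_add)

lemma periodic_diff: "periodic f \<Longrightarrow> periodic g \<Longrightarrow> periodic (\<lambda>x y. f x y - g x y)"
  by (simp add: periodic_def cong_diff)

lemma periodic_shift: "periodic f \<Longrightarrow> periodic (\<lambda>x y. f (x + a) (y + b))"
  by (simp add: periodic_def cong_add)

definition shear :: "nat \<Rightarrow> nat \<Rightarrow> (nat \<Rightarrow> nat \<Rightarrow> int) \<Rightarrow> nat \<Rightarrow> nat" where
  "shear a b f = (\<lambda>w\<in>\<Omega>. point (cX w + a) (cY w + b) (int (cZ w) + f (cX w) (cY w)))"

lemma shear_point:
  assumes "periodic f"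
  shows "shear a b f (point x y z) = point (x + a) (y + b) (z + f x y)"
proof -
  have "[f (x mod p) (y mod p) = f x y] (mod int p)"
    using assms by (intro periodicD) auto
  then show ?thesis
    by (auto simp: shear_def point_in coords_point point_eq_iff intro!: cong_add)
qed

lemma shear_PiE: "shear a b f \<in> \<Omega> \<rightarrow>\<^sub>E \<Omega>"
  by (auto simp: shear_def point_in)

lemma ext_on_points:
  assumes "g \<in> \<Omega> \<rightarrow>\<^sub>E A" "g' \<in> \<Omega> \<rightarrow>\<^sub>E B" "\<And>x y z. g (point x y z) = g' (point x y z)"
  shows "g = g'"
  by (rule extensionalityI[of _ \<Omega>]) (use assms in \<open>auto simp: PiE_iff elim!: point_cases\<close>)

lemma shear_compose:
  assumes "periodic f" "periodic f'"
  shows "compose \<Omega> (shear a b f) (shear a' b' f')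
    = shear (a' + a) (b' + b) (\<lambda>x y. f' x y + f (x + a') (y + b'))"
proof (rule ext_on_points)
  show "compose \<Omega> (shear a b f) (shear a' b' f') \<in> \<Omega> \<rightarrow>\<^sub>E \<Omega>"
    using PiE_mem[OF shear_PiE] by (simp add: compose_def)
  have "periodic (\<lambda>x y. f' x y + f (x + a') (y + b'))"
    using assms periodic_add periodic_shift by blast
  then show "compose \<Omega> (shear a b f) (shear a' b' f') (point x y z)
      = shear (a' + a) (b' + b) (\<lambda>x y. f' x y + f (x + a') (y + b')) (point x y z)" for x y z
    using assms by (simp add: compose_eq point_in shear_point algebra_simps)
qed (rule shear_PiE)

lemma shear_eq_iff:
  assumes "periodic f" "periodic f'"
  shows "shear a b f = shear a' b' f' \<longleftrightarrow>
    [a = a'] (mod p) \<and> [b = b'] (mod p) \<and> (\<forall>x y. [f x y = f' x y] (mod int p))"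
proof
  assume "shear a b f = shear a' b' f'"
  then have eq: "point (x + a) (y + b) (z + f x y) = point (x + a') (y + b') (z + f' x y)" for x y z
    using assms shear_point by metis
  show "[a = a'] (mod p) \<and> [b = b'] (mod p) \<and> (\<forall>x y. [f x y = f' x y] (mod int p))"
    using eq[of 0 0 0] eq[of _ _ 0] by (auto simp: point_eq_iff)
next
  assume "[a = a'] (mod p) \<and> [b = b'] (mod p) \<and> (\<forall>x y. [f x y = f' x y] (mod int p))"
  then show "shear a b f = shear a' b' f'"
    using assms by (intro ext_on_points[OF shear_PiE shear_PiE])
      (auto simp: shear_point point_eq_iff intro!: cong_add)
qed

lemma shear_id: "shear 0 0 (\<lambda>x y. 0) = (\<lambda>w\<in>\<Omega>. w)"
  by (rule ext_on_points[where A = \<Omega> and B = \<Omega>])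
     (auto simp: shear_PiE shear_point periodic_const point_in)

text \<open>
  The factor \<open>p - 1\<close> plays the role of \<open>- 1\<close>, as the translation part is given by natural numbers.
\<close>

lemma shear_left_inverse:
  assumes "periodic f"
  shows "compose \<Omega> (shear ((p - 1) * a) ((p - 1) * b) (\<lambda>x y. 0 - f (x + (p - 1) * a) (y + (p - 1) * b)))
      (shear a b f) = (\<lambda>w\<in>\<Omega>. w)"
proof -
  let ?f' = "\<lambda>x y. 0 - f (x + (p - 1) * a) (y + (p - 1) * b)"
  have f': "periodic ?f'"
    using periodic_diff[OF periodic_const periodic_shift[OF assms]] .
  have pm: "c + (p - 1) * c = p * c" for c
    using p_gt_1 by (cases p) simp_all
  have "[f x y - f (x + a + (p - 1) * a) (y + b + (p - 1) * b) = 0] (mod int p)" for x y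
  proof -
    have "[f x y = f (x + a + (p - 1) * a) (y + b + (p - 1) * b)] (mod int p)"
      unfolding add.assoc pm by (rule periodicD[OF assms]) (simp_all add: cong_def)
    then show ?thesis using cong_diff_iff_cong_0 by blast
  qed
  moreover have "periodic (\<lambda>x y. f x y + ?f' (x + a) (y + b))"
    by (rule periodic_add[OF assms periodic_shift[OF f']])
  ultimately show ?thesis
    unfolding shear_compose[OF f' assms] shear_id[symmetric]
    by (subst shear_eq_iff) (simp_all add: periodic_const pm[simplified] cong_0_iff)
qed

text \<open>
  Modulo \<open>p\<close>, these are the polynomial functions of total degree at most \<open>p - 2\<close>.  Defining them by
  annihilation makes it evident that they are closed under addition and translation.
\<close>

definition V :: "(nat \<Rightarrow> nat \<Rightarrow> int) set" where
  "V = {f. periodic f \<and> (\<forall>i j x y. i + j = p - 1 \<longrightarrow> int p dvd mixed_diff i j f x y)}"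

lemma V_periodic: "f \<in> V \<Longrightarrow> periodic f"
  by (simp add: V_def)

lemma V_const: "(\<lambda>x y. c) \<in> V"
  using p_gt_1 by (auto simp: V_def periodic_const mixed_diff_const)

lemma V_add: "f \<in> V \<Longrightarrow> g \<in> V \<Longrightarrow> (\<lambda>x y. f x y + g x y) \<in> V"
  by (simp add: V_def periodic_add mixed_diff_add)

lemma V_diff: "f \<in> V \<Longrightarrow> g \<in> V \<Longrightarrow> (\<lambda>x y. f x y - g x y) \<in> V"
  by (simp add: V_def periodic_diff mixed_diff_diff)

lemma V_shift: "f \<in> V \<Longrightarrow> (\<lambda>x y. f (x + a) (y + b)) \<in> V"
  by (simp add: V_def periodic_shift mixed_diff_shift)

definition \<Gamma> :: "(nat \<Rightarrow> nat) set" where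
  "\<Gamma> = {shear a b f | a b f. f \<in> V}"

lemma \<Gamma>_subgroup: "subgroup \<Gamma> (BijGroup \<Omega>)"
proof (rule subgroup_BijGroupI)
  show "(\<lambda>x\<in>\<Omega>. x) \<in> \<Gamma>"
    using V_const[of 0] unfolding \<Gamma>_def shear_id[symmetric] by blast
  show "compose \<Omega> f g \<in> \<Gamma>" if fg: "f \<in> \<Gamma>" "g \<in> \<Gamma>" for f g
  proof -
    obtain a b u a' b' u' where *: "f = shear a b u" "g = shear a' b' u'" "u \<in> V" "u' \<in> V"
      using fg by (auto simp: \<Gamma>_def)
    then have "compose \<Omega> f g = shear (a' + a) (b' + b) (\<lambda>x y. u' x y + u (x + a') (y + b'))"
      by (simp add: shear_compose V_periodic)
    moreover have "(\<lambda>x y. u' x y + u (x + a') (y + b')) \<in> V"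
      using * V_add V_shift by blast
    ultimately show ?thesis unfolding \<Gamma>_def by blast
  qed
  show "\<exists>g'\<in>\<Gamma>. compose \<Omega> g' g = (\<lambda>x\<in>\<Omega>. x)" if g: "g \<in> \<Gamma>" for g
  proof -
    obtain a b u where *: "g = shear a b u" "u \<in> V" using g by (auto simp: \<Gamma>_def)
    have "(\<lambda>x y. 0 - u (x + (p - 1) * a) (y + (p - 1) * b)) \<in> V"
      using V_diff[OF V_const V_shift[OF *(2)]] .
    then have "shear ((p - 1) * a) ((p - 1) * b) (\<lambda>x y. 0 - u (x + (p - 1) * a) (y + (p - 1) * b)) \<in> \<Gamma>"
      unfolding \<Gamma>_def by blast
    then show ?thesis using shear_left_inverse[OF V_periodic[OF *(2)], of a b] *(1) by blast
  qed
qed (use shear_PiE in \<open>auto simp: \<Gamma>_def\<close>)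

lemma \<Gamma>_transitive: "transitive_perm_group \<Omega> \<Gamma>"
proof (rule transitive_perm_groupI[OF \<Gamma>_subgroup])
  fix w w' assume "w \<in> \<Omega>" "w' \<in> \<Omega>"
  then obtain x y z x' y' z' where w: "w = point x y z" "w' = point x' y' z'"
    by (metis point_cases)
  \<comment> \<open>The translation by \<open>c x + x'\<close> stands for the one by \<open>x' - x\<close>.\<close>
  define c where "c u = (p - 1) * u" for u :: nat
  have pm: "u + c u = p * u" for u
    using p_gt_1 unfolding c_def by (cases p) simp_all
  have "shear (c x + x') (c y + y') (\<lambda>x y. z' - z) w = w'"
    unfolding w by (simp add: shear_point periodic_const point_eq_iff pm cong_def flip: add.assoc)
  moreover have "shear (c x + x') (c y + y') (\<lambda>x y. z' - z) \<in> \<Gamma>"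
    using V_const unfolding \<Gamma>_def by blast
  ultimately show "\<exists>g\<in>\<Gamma>. g w = w'" by blast
qed

lemma finite_\<Omega>: "finite \<Omega>" by (simp add: \<Omega>_def)

lemma finite_\<Gamma>: "finite \<Gamma>"
proof (rule finite_subset)
  show "\<Gamma> \<subseteq> \<Omega> \<rightarrow>\<^sub>E \<Omega>" using shear_PiE by (auto simp: \<Gamma>_def)
qed (simp add: finite_PiE finite_\<Omega>)

lemma shear_funpow:
  assumes "periodic f"
  shows "(shear a b f ^^ n) (point x y z)
    = point (x + n * a) (y + n * b) (z + (\<Sum>i<n. f (x + i * a) (y + i * b)))"
  by (induction n) (simp_all add: shear_point assms algebra_simps)

text \<open>
  After \<open>p ^ 2\<close> steps the third coordinate has grown by a sum over \<open>p\<close> full periods of a sequence of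
  period \<open>p\<close>, which is \<open>p\<close> times the sum over one period.
\<close>

lemma shear_exponent:
  assumes "periodic f" "w \<in> \<Omega>"
  shows "(shear a b f ^^ (p ^ 2)) w = w"
proof -
  obtain x y z where w: "w = point x y z" using assms(2) by (rule point_cases)
  let ?F = "\<lambda>i. f (x + i * a) (y + i * b)"
  have "[sum ?F {m * p..<m * p + p} = sum ?F {..<p}] (mod int p)" for m
  proof -
    have "sum ?F {m * p..<m * p + p} = (\<Sum>i<p. ?F (i + m * p))"
      using sum.shift_bounds_nat_ivl[of ?F 0 "m * p" p] by (simp add: lessThan_atLeast0 add.commute)
    also have "[\<dots> = sum ?F {..<p}] (mod int p)"
    proof (intro cong_sum periodicD[OF assms(1)])
      fix i
      have "[c + (i + m * p) * d = c + i * d] (mod p)" for c d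
      proof -
        have "c + (i + m * p) * d = (c + i * d) + p * (m * d)" by (simp add: algebra_simps)
        then show ?thesis by (simp only: cong_def mod_mult_self2)
      qed
      then show "[x + (i + m * p) * a = x + i * a] (mod p)" "[y + (i + m * p) * b = y + i * b] (mod p)"
        by blast+
    qed
    finally show ?thesis .
  qed
  then have "[(\<Sum>m<p. sum ?F {m * p..<m * p + p}) = (\<Sum>m<p. sum ?F {..<p})] (mod int p)"
    by (intro cong_sum)
  then have "[sum ?F {..<p * p} = 0] (mod int p)"
    unfolding sum.nat_group by (simp add: cong_def)
  then show ?thesis
    unfolding w power2_eq_square shear_funpow[OF assms(1)]
    by (simp add: point_eq_iff cong_def mult.assoc flip: mod_add_right_eq[of z])
qed

lemma \<Gamma>_p_group: "p_group p (perm_group \<Omega> \<Gamma>)"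
proof (rule p_groupI_exponent[OF perm_group_group[OF \<Gamma>_subgroup] _ prime_p])
  fix g assume "g \<in> carrier (perm_group \<Omega> \<Gamma>)"
  then have g: "g \<in> \<Gamma>" by simp
  then obtain a b f where "g = shear a b f" "periodic f" using V_periodic by (auto simp: \<Gamma>_def)
  then show "g [^]\<^bsub>perm_group \<Omega> \<Gamma>\<^esub> (p ^ 2) = \<one>\<^bsub>perm_group \<Omega> \<Gamma>\<^esub>"
    using shear_exponent by (intro perm_group_pow_eq_one[OF \<Gamma>_subgroup g]) simp
qed (simp add: finite_\<Gamma>)

section \<open>The action on vertical lines\<close>

definition block :: "nat \<Rightarrow> nat \<Rightarrow> nat set" where
  "block x y = range (point x y)"

definition \<B> :: "nat set set" where
  "\<B> = {block x y | x y. True}"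

lemma block_eq_iff: "block x y = block x' y' \<longleftrightarrow> [x = x'] (mod p) \<and> [y = y'] (mod p)"
proof
  assume "block x y = block x' y'"
  then have "point x y 0 \<in> range (point x' y')" by (auto simp: block_def)
  then show "[x = x'] (mod p) \<and> [y = y'] (mod p)" by (auto simp: point_eq_iff)
next
  assume "[x = x'] (mod p) \<and> [y = y'] (mod p)"
  then have "point x y z = point x' y' z" for z by (simp add: point_eq_iff)
  then show "block x y = block x' y'" by (simp add: block_def)
qed

lemma shear_block:
  assumes "periodic f"
  shows "shear a b f ` block x y = block (x + a) (y + b)"
proof -
  have "shear a b f ` block x y = range (\<lambda>z. point (x + a) (y + b) (z + f x y))"
    unfolding block_def image_image by (simp add: shear_point[OF assms])
  also have "\<dots> = point (x + a) (y + b) ` range (\<lambda>z. z + f x y)"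
    unfolding image_image ..
  also have "range (\<lambda>z. z + f x y) = UNIV"
    by (rule surjI[of _ "\<lambda>z. z - f x y"]) simp
  finally show ?thesis unfolding block_def .
qed

lemma block_in_\<B>: "block x y \<in> \<B>"
  by (auto simp: \<B>_def)

lemma imprimitivity_\<B>: "imprimitivity_system \<Omega> \<Gamma> \<B>"
  unfolding imprimitivity_system_def
proof (intro conjI ballI)
  show "partition_on \<Omega> \<B>"
  proof (rule partition_onI)
    show "\<Union> \<B> = \<Omega>"
      by (auto simp: \<B>_def block_def point_in elim!: point_cases)
    fix A B assume "A \<in> \<B>" "B \<in> \<B>" "A \<noteq> B"
    then obtain x y x' y' where AB: "A = block x y" "B = block x' y'" by (auto simp: \<B>_def)
    then have "\<not> ([x = x'] (mod p) \<and> [y = y'] (mod p))"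
      using \<open>A \<noteq> B\<close> block_eq_iff by blast
    then show "disjnt A B" unfolding AB by (auto simp: disjnt_def block_def point_eq_iff)
  next
    show "{} \<notin> \<B>" by (auto simp: \<B>_def block_def)
  qed
next
  fix g B assume g: "g \<in> \<Gamma>" and B: "B \<in> \<B>"
  obtain a b f where g': "g = shear a b f" "periodic f" using g V_periodic by (auto simp: \<Gamma>_def)
  obtain x y where "B = block x y" using B by (auto simp: \<B>_def)
  then show "g ` B \<in> \<B>" using g' by (simp add: shear_block block_in_\<B>)
qed

definition block_shift :: "nat \<Rightarrow> nat \<Rightarrow> nat set \<Rightarrow> nat set" where
  "block_shift a b = block_action \<B> (shear a b (\<lambda>x y. 0))"

lemma block_shift_block: "block_shift a b (block x y) = block (x + a) (y + b)"
  by (simp add: block_shift_def block_action_def block_in_\<B> shear_block periodic_const)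

text \<open>
  The blocks are the vertical lines, and \<open>f\<close> moves points only within these, so
  \<open>\<Gamma>\<close> induces translations of the plane.
\<close>

lemma block_action_shear:
  assumes "periodic f"
  shows "block_action \<B> (shear a b f) = block_shift a b"
  unfolding block_shift_def block_action_def
  unfolding \<B>_def by (rule restrict_ext) (clarsimp simp only: shear_block assms periodic_const)

lemma block_shift_PiE: "block_shift a b \<in> \<B> \<rightarrow>\<^sub>E \<B>"
proof (rule PiE_I)
  show "block_shift a b B \<in> \<B>" if "B \<in> \<B>" for B
    using that block_in_\<B> by (auto simp: \<B>_def block_shift_block)
qed (simp add: block_shift_def block_action_def)

lemma ext_on_blocks:
  assumes "g \<in> \<B> \<rightarrow>\<^sub>E A" "g' \<in> \<B> \<rightarrow>\<^sub>E B" "\<And>x y. g (block x y) = g' (block x y)"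
  shows "g = g'"
  by (rule extensionalityI[of _ \<B>]) (use assms in \<open>auto simp: PiE_iff \<B>_def\<close>)

lemma induced_group_eq: "induced_group \<B> \<Gamma> = {block_shift a b | a b. True}"
proof (intro equalityI subsetI)
  fix g assume g: "g \<in> induced_group \<B> \<Gamma>"
  obtain a b f where "g = block_action \<B> (shear a b f)" "f \<in> V"
    using g by (auto simp: induced_group_def \<Gamma>_def)
  then show "g \<in> {block_shift a b | a b. True}" using block_action_shear[OF V_periodic] by blast
next
  fix g assume g: "g \<in> {block_shift a b | a b. True}"
  have "shear a b (\<lambda>x y. 0) \<in> \<Gamma>" for a b using V_const unfolding \<Gamma>_def by blast
  then have "block_shift a b \<in> induced_group \<B> \<Gamma>" for a b
    unfolding induced_group_def block_shift_def by (rule imageI)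
  then show "g \<in> induced_group \<B> \<Gamma>" using g by blast
qed

lemma block_shift_compose:
  "compose \<B> (block_shift a b) (block_shift a' b') = block_shift (a' + a) (b' + b)"
proof (rule ext_on_blocks)
  show "compose \<B> (block_shift a b) (block_shift a' b') \<in> \<B> \<rightarrow>\<^sub>E \<B>"
    using PiE_mem[OF block_shift_PiE] by (simp add: compose_def)
  show "block_shift (a' + a) (b' + b) \<in> \<B> \<rightarrow>\<^sub>E \<B>" by (rule block_shift_PiE)
qed (simp add: compose_eq block_in_\<B> block_shift_block add.assoc)

lemma block_shift_eq_id:
  assumes "p dvd a" "p dvd b"
  shows "block_shift a b = (\<lambda>B\<in>\<B>. B)"
proof (rule ext_on_blocks[OF block_shift_PiE])
  show "(\<lambda>B\<in>\<B>. B) \<in> \<B> \<rightarrow>\<^sub>E \<B>" by auto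
  have "[u + v = u] (mod p)" if "p dvd v" for u v
    using that by (auto simp: cong_def elim!: dvdE)
  then show "block_shift a b (block x y) = (\<lambda>B\<in>\<B>. B) (block x y)" for x y
    using assms by (simp add: block_shift_block block_in_\<B> block_eq_iff)
qed

lemma induced_subgroup: "subgroup (induced_group \<B> \<Gamma>) (BijGroup \<B>)"
proof (rule subgroup_BijGroupI)
  have pm: "c + (p - 1) * c = p * c" for c using p_gt_1 by (cases p) simp_all
  show "(\<lambda>x\<in>\<B>. x) \<in> induced_group \<B> \<Gamma>"
    unfolding induced_group_eq using block_shift_eq_id[of 0 0, symmetric] by blast
  show "\<exists>g'\<in>induced_group \<B> \<Gamma>. compose \<B> g' g = (\<lambda>x\<in>\<B>. x)" if g: "g \<in> induced_group \<B> \<Gamma>" for g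
  proof -
    obtain a b where "g = block_shift a b" using g unfolding induced_group_eq by auto
    then have "compose \<B> (block_shift ((p - 1) * a) ((p - 1) * b)) g = (\<lambda>x\<in>\<B>. x)"
      using block_shift_eq_id[of "p * a" "p * b"] by (simp add: block_shift_compose pm[simplified])
    then show ?thesis unfolding induced_group_eq by blast
  qed
  show "compose \<B> f g \<in> induced_group \<B> \<Gamma>"
    if "f \<in> induced_group \<B> \<Gamma>" "g \<in> induced_group \<B> \<Gamma>" for f g
    using that unfolding induced_group_eq by clarify (unfold block_shift_compose, blast)
qed (use block_shift_PiE in \<open>auto simp: induced_group_eq\<close>)

lemma induced_regular: "regular_perm_group \<B> (induced_group \<B> \<Gamma>)"
proof (rule regular_perm_groupI[OF induced_subgroup])
  fix A B assume "A \<in> \<B>" "B \<in> \<B>"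
  then obtain x y x' y' where AB: "A = block x y" "B = block x' y'" by (auto simp: \<B>_def)
  have pm: "c + ((p - 1) * c + d) = p * c + d" for c d using p_gt_1 by (cases p) simp_all
  have "block_shift ((p - 1) * x + x') ((p - 1) * y + y') A = B"
    unfolding AB block_shift_block pm by (simp add: block_eq_iff cong_def)
  then show "\<exists>g\<in>induced_group \<B> \<Gamma>. g A = B" unfolding induced_group_eq by blast
next
  fix g A B assume "g \<in> induced_group \<B> \<Gamma>" "A \<in> \<B>" "g A = A" "B \<in> \<B>"
  moreover obtain a b where g: "g = block_shift a b"
    using \<open>g \<in> induced_group \<B> \<Gamma>\<close> unfolding induced_group_eq by blast
  moreover obtain x y where "A = block x y" using \<open>A \<in> \<B>\<close> unfolding \<B>_def by blast
  ultimately have "block (x + a) (y + b) = block x y" by (simp add: block_shift_block)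
  then have "[a = 0] (mod p)" "[b = 0] (mod p)"
    by (simp_all add: block_eq_iff cong_add_lcancel_0_nat)
  then show "g B = B"
    using block_shift_eq_id[of a b] \<open>B \<in> \<B>\<close> g by (simp add: cong_0_iff)
qed

lemma card_\<B>: "card \<B> = p ^ 2"
proof -
  have "\<B> = (\<lambda>(x, y). block x y) ` ({..<p} \<times> {..<p})"
  proof (intro equalityI subsetI)
    fix B assume "B \<in> \<B>"
    then obtain x y where "B = block x y" by (auto simp: \<B>_def)
    also have "\<dots> = block (x mod p) (y mod p)" by (simp add: block_eq_iff)
    finally show "B \<in> (\<lambda>(x, y). block x y) ` ({..<p} \<times> {..<p})"
      using p_gt_1 by (intro image_eqI[of _ _ "(x mod p, y mod p)"]) auto
  qed (auto simp: block_in_\<B>)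
  moreover have "inj_on (\<lambda>(x, y). block x y) ({..<p} \<times> {..<p})"
    by (auto simp: inj_on_def block_eq_iff cong_def)
  ultimately show ?thesis by (simp add: card_image power2_eq_square)
qed

lemma induced_elementary_abelian: "elementary_abelian p 2 (perm_group \<B> (induced_group \<B> \<Gamma>))"
proof (rule elementary_abelianI[OF _ prime_p])
  interpret group "perm_group \<B> (induced_group \<B> \<Gamma>)"
    by (rule perm_group_group[OF induced_subgroup])
  show "comm_group (perm_group \<B> (induced_group \<B> \<Gamma>))"
  proof (rule group_comm_groupI)
    fix f g assume "f \<in> carrier (perm_group \<B> (induced_group \<B> \<Gamma>))"
      "g \<in> carrier (perm_group \<B> (induced_group \<B> \<Gamma>))"
    then have fg: "f \<in> induced_group \<B> \<Gamma>" "g \<in> induced_group \<B> \<Gamma>" by simp_all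
    then have "compose \<B> f g = compose \<B> g f"
      by (auto simp: induced_group_eq block_shift_compose add.commute)
    then show "f \<otimes>\<^bsub>perm_group \<B> (induced_group \<B> \<Gamma>)\<^esub> g = g \<otimes>\<^bsub>perm_group \<B> (induced_group \<B> \<Gamma>)\<^esub> f"
      using fg by (simp only: perm_group_mult[OF induced_subgroup])
  qed
  have "\<B> \<noteq> {}" using block_in_\<B> by blast
  then show "order (perm_group \<B> (induced_group \<B> \<Gamma>)) = p ^ 2"
    using order_regular_perm_group[OF induced_regular] by (simp add: card_\<B>)
  fix g assume "g \<in> carrier (perm_group \<B> (induced_group \<B> \<Gamma>))"
  then have g: "g \<in> induced_group \<B> \<Gamma>" by simp
  then obtain a b where g': "g = block_shift a b" unfolding induced_group_eq by auto
  have "(g ^^ n) (block x y) = block (x + n * a) (y + n * b)" for n x y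
    by (induction n) (simp_all add: g' block_shift_block algebra_simps)
  moreover have "block (x + p * a) (y + p * b) = block x y" for x y
    by (simp add: block_eq_iff cong_def)
  ultimately have "(g ^^ p) (block x y) = block x y" for x y by metis
  then have "(g ^^ p) B = B" if "B \<in> \<B>" for B
    using that unfolding \<B>_def by blast
  then show "g [^]\<^bsub>perm_group \<B> (induced_group \<B> \<Gamma>)\<^esub> p = \<one>\<^bsub>perm_group \<B> (induced_group \<B> \<Gamma>)\<^esub>"
    by (rule perm_group_pow_eq_one[OF induced_subgroup g])
qed

lemma \<Gamma>_in_class_E: "\<Gamma> \<in> class_E p \<Omega>"
  unfolding class_E_def
  using \<Gamma>_transitive \<Gamma>_p_group imprimitivity_\<B> induced_regular induced_elementary_abelian
  by (auto simp: \<Omega>_def)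

section \<open>Twisted translation groups\<close>

text \<open>
  The functions \<open>h\<close> whose twisted translation group, introduced next, lies in \<open>\<Gamma>\<close>.  Their degree
  may be \<open>p - 1\<close>, one more than in \<open>V\<close>.
\<close>

definition W :: "(nat \<Rightarrow> nat \<Rightarrow> int) set" where
  "W = {h. periodic h \<and> (\<forall>a b. (\<lambda>x y. h (x + a) (y + b) - h x y) \<in> V)}"

definition twist :: "(nat \<Rightarrow> nat \<Rightarrow> int) \<Rightarrow> nat \<Rightarrow> nat \<Rightarrow> int \<Rightarrow> nat \<Rightarrow> nat" where
  "twist h a b c = shear a b (\<lambda>x y. h (x + a) (y + b) - h x y + c)"

text \<open>
  The conjugate of the group of all translations \<open>(x, y, z) \<mapsto> (x + a, y + b, z + c)\<close> by the map
  \<open>(x, y, z) \<mapsto> (x, y, z + h x y)\<close>, which in general lies outside of \<open>\<Gamma>\<close>.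
\<close>

definition twisted_group :: "(nat \<Rightarrow> nat \<Rightarrow> int) \<Rightarrow> (nat \<Rightarrow> nat) set" where
  "twisted_group h = {twist h a b c | a b c. True}"

lemma periodic_twist:
  assumes "periodic h"
  shows "periodic (\<lambda>x y. h (x + a) (y + b) - h x y + c)"
  by (rule periodic_add[OF periodic_diff[OF periodic_shift[OF assms] assms] periodic_const])

lemma twist_point:
  "periodic h \<Longrightarrow>
    twist h a b c (point x y z) = point (x + a) (y + b) (z + (h (x + a) (y + b) - h x y + c))"
  unfolding twist_def by (rule shear_point[OF periodic_twist])

lemma twist_cong:
  assumes "periodic h" "[a = a'] (mod p)" "[b = b'] (mod p)" "[c = c'] (mod int p)"
  shows "twist h a b c = twist h a' b' c'"
  unfolding twist_def shear_eq_iff[OF periodic_twist[OF assms(1)] periodic_twist[OF assms(1)]]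
  using assms(2-) by (auto intro!: cong_add cong_diff periodicD[OF assms(1)])

text \<open>
  The terms with \<open>h\<close> telescope, so composition adds the parameters as in the translation group.
\<close>

lemma twist_compose:
  assumes "periodic h"
  shows "compose \<Omega> (twist h a b c) (twist h a' b' c') = twist h (a + a') (b + b') (c + c')"
proof (rule ext_on_points)
  show "compose \<Omega> (twist h a b c) (twist h a' b' c') \<in> \<Omega> \<rightarrow>\<^sub>E \<Omega>"
    using PiE_mem[OF shear_PiE] by (simp add: compose_def twist_def)
  show "twist h (a + a') (b + b') (c + c') \<in> \<Omega> \<rightarrow>\<^sub>E \<Omega>"
    unfolding twist_def by (rule shear_PiE)
qed (simp add: compose_eq point_in twist_point[OF assms] ac_simps)

lemma twist_id:
  assumes "periodic h"
  shows "twist h 0 0 0 = (\<lambda>w\<in>\<Omega>. w)"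
  unfolding twist_def shear_id[symmetric] by simp

context
  fixes h assumes h: "periodic h"
begin

lemma twisted_subgroup: "subgroup (twisted_group h) (BijGroup \<Omega>)"
proof (rule subgroup_BijGroupI)
  show "(\<lambda>w\<in>\<Omega>. w) \<in> twisted_group h"
    unfolding twisted_group_def twist_id[OF h, symmetric] by blast
  show "compose \<Omega> f g \<in> twisted_group h" if "f \<in> twisted_group h" "g \<in> twisted_group h" for f g
    using that unfolding twisted_group_def by clarify (unfold twist_compose[OF h], blast)
  show "\<exists>g'\<in>twisted_group h. compose \<Omega> g' g = (\<lambda>w\<in>\<Omega>. w)" if g: "g \<in> twisted_group h" for g
  proof -
    obtain a b c where g': "g = twist h a b c" using g unfolding twisted_group_def by blast
    have pm: "(p - 1) * d + d = p * d" for d using p_gt_1 by (cases p) simp_all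
    have "compose \<Omega> (twist h ((p - 1) * a) ((p - 1) * b) (- c)) g = twist h (p * a) (p * b) 0"
      unfolding g' twist_compose[OF h] pm by simp
    also have "\<dots> = twist h 0 0 0"
      by (rule twist_cong[OF h]) (simp_all add: cong_def)
    finally show ?thesis unfolding twist_id[OF h] twisted_group_def by blast
  qed
qed (use shear_PiE in \<open>auto simp: twisted_group_def twist_def\<close>)

lemma twisted_regular: "regular_perm_group \<Omega> (twisted_group h)"
proof (rule regular_perm_groupI[OF twisted_subgroup])
  fix w w' assume "w \<in> \<Omega>" "w' \<in> \<Omega>"
  then obtain x y z x' y' z' where w: "w = point x y z" "w' = point x' y' z'"
    by (metis point_cases)
  have pm: "c + ((p - 1) * c + d) = p * c + d" for c d using p_gt_1 by (cases p) simp_all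
  let ?a = "(p - 1) * x + x'" and ?b = "(p - 1) * y + y'"
  have "twist h ?a ?b (z' - z - (h (x + ?a) (y + ?b) - h x y)) w = w'"
    unfolding w twist_point[OF h] pm by (simp add: point_eq_iff cong_def)
  then show "\<exists>g\<in>twisted_group h. g w = w'" unfolding twisted_group_def by blast
next
  fix g w w' assume g: "g \<in> twisted_group h" and w: "w \<in> \<Omega>" "g w = w" "w' \<in> \<Omega>"
  obtain a b c where g': "g = twist h a b c" using g unfolding twisted_group_def by blast
  obtain x y z where xyz: "w = point x y z" using w(1) by (rule point_cases)
  have eq: "point (x + a) (y + b) (z + (h (x + a) (y + b) - h x y + c)) = point x y z"
    using w(2) unfolding xyz g' twist_point[OF h] .
  then have ab: "[a = 0] (mod p)" "[b = 0] (mod p)"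
    by (simp_all add: point_eq_iff cong_add_lcancel_0_nat)
  have "[h (x + a) (y + b) - h x y + c = 0] (mod int p)"
    using eq by (simp add: point_eq_iff cong_add_lcancel_0)
  moreover have "[h (x + a) (y + b) - h x y = 0] (mod int p)"
    using periodicD[OF h cong_add[OF cong_refl ab(1)] cong_add[OF cong_refl ab(2)], of x y]
    by (simp add: cong_diff_iff_cong_0)
  ultimately have "[c = 0] (mod int p)" by (simp add: cong_0_iff dvd_add_right_iff)
  then have "g = (\<lambda>w\<in>\<Omega>. w)"
    using twist_cong[OF h ab] twist_id[OF h] g' by simp
  then show "g w' = w'" using w(3) by simp
qed

lemma twist_funpow:
  "(twist h a b c ^^ n) (point x y z)
    = point (x + n * a) (y + n * b) (z + (h (x + n * a) (y + n * b) - h x y + int n * c))"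
  by (induction n) (simp_all add: twist_point[OF h] algebra_simps)

lemma twisted_elementary_abelian: "elementary_abelian p 3 (perm_group \<Omega> (twisted_group h))"
proof (rule elementary_abelianI[OF _ prime_p])
  interpret group "perm_group \<Omega> (twisted_group h)"
    by (rule perm_group_group[OF twisted_subgroup])
  show "comm_group (perm_group \<Omega> (twisted_group h))"
  proof (rule group_comm_groupI)
    fix f g assume "f \<in> carrier (perm_group \<Omega> (twisted_group h))"
      "g \<in> carrier (perm_group \<Omega> (twisted_group h))"
    then have fg: "f \<in> twisted_group h" "g \<in> twisted_group h" by simp_all
    then have "compose \<Omega> f g = compose \<Omega> g f"
      by (auto simp: twisted_group_def twist_compose[OF h] add.commute)
    then show "f \<otimes>\<^bsub>perm_group \<Omega> (twisted_group h)\<^esub> g = g \<otimes>\<^bsub>perm_group \<Omega> (twisted_group h)\<^esub> f"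
      using fg by (simp only: perm_group_mult[OF twisted_subgroup])
  qed
  have "\<Omega> \<noteq> {}" using point_in by blast
  then show "order (perm_group \<Omega> (twisted_group h)) = p ^ 3"
    using order_regular_perm_group[OF twisted_regular] by (simp add: \<Omega>_def)
  fix g assume "g \<in> carrier (perm_group \<Omega> (twisted_group h))"
  then have g: "g \<in> twisted_group h" by simp
  then obtain a b c where g': "g = twist h a b c" unfolding twisted_group_def by blast
  have "(g ^^ p) w = w" if w: "w \<in> \<Omega>" for w
  proof -
    obtain x y z where xyz: "w = point x y z" using w by (rule point_cases)
    have "[h (x + p * a) (y + p * b) - h x y = 0] (mod int p)"
      unfolding cong_diff_iff_cong_0 by (rule periodicD[OF h]) (simp_all add: cong_def)
    then have "[h (x + p * a) (y + p * b) - h x y + int p * c = 0] (mod int p)"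
      by (simp add: cong_def)
    then show ?thesis
      unfolding xyz g' twist_funpow point_eq_iff cong_add_lcancel_0 by (simp add: cong_def)
  qed
  then show "g [^]\<^bsub>perm_group \<Omega> (twisted_group h)\<^esub> p = \<one>\<^bsub>perm_group \<Omega> (twisted_group h)\<^esub>"
    by (rule perm_group_pow_eq_one[OF twisted_subgroup g])
qed

end

lemma W_periodic: "h \<in> W \<Longrightarrow> periodic h"
  by (simp add: W_def)

lemma twisted_subset_\<Gamma>:
  assumes "h \<in> W"
  shows "twisted_group h \<subseteq> \<Gamma>"
proof
  fix g assume "g \<in> twisted_group h"
  then obtain a b c where "g = twist h a b c" unfolding twisted_group_def by blast
  moreover have "(\<lambda>x y. h (x + a) (y + b) - h x y) \<in> V"
    using assms by (simp add: W_def)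
  then have "(\<lambda>x y. h (x + a) (y + b) - h x y + c) \<in> V"
    using V_const by (rule V_add)
  ultimately show "g \<in> \<Gamma>" unfolding twist_def \<Gamma>_def by blast
qed

lemma twisted_in_Reg:
  assumes "h \<in> W" "elementary_abelian p 3 H"
  shows "twisted_group h \<in> Reg \<Omega> \<Gamma> H"
proof -
  have "subgroup (twisted_group h) (perm_group \<Omega> \<Gamma>)"
    using assms W_periodic
    by (intro group.subgroup_incl group_BijGroup twisted_subgroup \<Gamma>_subgroup twisted_subset_\<Gamma>)
  moreover have "perm_group \<Omega> (twisted_group h) \<cong> H"
    using elementary_abelian_unique[OF prime_p twisted_elementary_abelian assms(2)] assms(1) W_periodic
    by blast
  ultimately show ?thesis using twisted_regular W_periodic assms(1) by (auto simp: Reg_def)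
qed

text \<open>
  Let the conjugating element be the shear with parameters \<open>a\<close>, \<open>b\<close> and \<open>v\<close>.  It suffices to follow
  the twist of the unit translation in \<open>x\<close>.  Its conjugate is a twist by \<open>h'\<close> which, compared on the
  first two coordinates, is also a unit translation in \<open>x\<close>.  Comparing the third coordinates, the
  function \<open>u\<close> that maps \<open>(x, y)\<close> to \<open>h x y + v x y - h' (x + a) (y + b)\<close> has a constant first
  difference in \<open>x\<close>.  Therefore its differences of positive order in both variables vanish, and those
  of \<open>v\<close> of total order \<open>p - 1\<close> vanish by the definition of \<open>V\<close>.
\<close>

lemma conjugate_twisted_invariant:
  assumes hW: "h \<in> W" "h' \<in> W" and g: "g \<in> \<Gamma>"
    and conj: "\<And>t. t \<in> twisted_group h \<Longrightarrow> \<exists>t'\<in>twisted_group h'. compose \<Omega> g t = compose \<Omega> t' g"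
  shows "\<exists>a b. \<forall>i j x y. Suc i + Suc j = p - 1 \<longrightarrow>
    [mixed_diff (Suc i) (Suc j) h x y = mixed_diff (Suc i) (Suc j) h' (x + a) (y + b)] (mod int p)"
proof -
  have h: "periodic h" and h': "periodic h'" using hW W_periodic by auto
  obtain a b v where g': "g = shear a b v" "v \<in> V" using g by (auto simp: \<Gamma>_def)
  note v = V_periodic[OF g'(2)]
  have "twist h 1 0 0 \<in> twisted_group h" unfolding twisted_group_def by blast
  from conj[OF this] obtain a' b' c where
    eq: "compose \<Omega> g (twist h 1 0 0) = compose \<Omega> (twist h' a' b' c) g"
    unfolding twisted_group_def by blast
  then have pt: "g (twist h 1 0 0 (point x y z)) = twist h' a' b' c (g (point x y z))" for x y z
    by (metis compose_eq point_in)
  have pt': "point (x + 1 + a) (y + b) (z + (h (x + 1) y - h x y) + v (x + 1) y)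
      = point (x + a + a') (y + b + b') (z + v x y + (h' (x + a + a') (y + b + b') - h' (x + a) (y + b) + c))"
    for x y z
    using pt[of x y z] unfolding g' by (simp add: twist_point h h' shear_point v)
  define u where "u x y = h x y + v x y - h' (x + a) (y + b)" for x y
  have "int p dvd u (Suc x) y - u x y - c" for x y
  proof -
    have "[h (x + 1) y - h x y + v (x + 1) y
        = v x y + (h' (x + a + a') (y + b + b') - h' (x + a) (y + b) + c)] (mod int p)"
      and sh: "[x + 1 + a = x + a + a'] (mod p)" "[y + b = y + b + b'] (mod p)"
      using pt'[of x y 0] by (simp_all add: point_eq_iff)
    moreover have "[h' (x + 1 + a) (y + b) = h' (x + a + a') (y + b + b')] (mod int p)"
      using h' sh by (rule periodicD)
    ultimately show ?thesis
      unfolding cong_iff_dvd_diff u_def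
      by (simp add: algebra_simps) (smt (verit) dvd_diff diff_diff_eq2)
  qed
  then have u: "int p dvd mixed_diff (Suc i) (Suc j) u x y" for i j x y
    by (rule mixed_diff_dvd_of_const_step)
  have md: "mixed_diff i j u x y = mixed_diff i j h x y + mixed_diff i j v x y - mixed_diff i j h' (x + a) (y + b)"
    for i j x y
    unfolding u_def by (simp add: mixed_diff_diff mixed_diff_add mixed_diff_shift)
  have "[mixed_diff (Suc i) (Suc j) h x y = mixed_diff (Suc i) (Suc j) h' (x + a) (y + b)] (mod int p)"
    if "Suc i + Suc j = p - 1" for i j x y
  proof -
    have "int p dvd mixed_diff (Suc i) (Suc j) v x y"
      using g'(2) that by (auto simp: V_def)
    with u[of i j x y] have "int p dvd mixed_diff (Suc i) (Suc j) u x y - mixed_diff (Suc i) (Suc j) v x y"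
      by (rule dvd_diff)
    then show ?thesis unfolding md cong_iff_dvd_diff by (simp add: algebra_simps)
  qed
  then show ?thesis by blast
qed

text \<open>
  The homogeneous part of degree \<open>p - 1\<close>, in the basis of products of binomial coefficients, without
  the two pure terms \<open>i = 0\<close> and \<open>i = p - 1\<close>: the conjugacy invariant only sees differences of positive
  order in both variables.  For \<open>p = 2\<close> the sum is empty.
\<close>

definition potential :: "(nat \<Rightarrow> nat) \<Rightarrow> nat \<Rightarrow> nat \<Rightarrow> int" where
  "potential s x y = (\<Sum>i\<in>{1..p - 2}. int (s i) * int (x choose i) * int (y choose (p - 1 - i)))"

text \<open>
  Since \<open>i + j = p - 1\<close>, every term with index \<open>k \<noteq> i\<close> is differentiated too often in one of the
  two variables, and the term with index \<open>i\<close> is reduced to its coefficient.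
\<close>

lemma mixed_diff_potential:
  assumes "i + j = p - 1"
  shows "mixed_diff i j (potential s) x y = (if i \<in> {1..p - 2} then int (s i) else 0)"
proof -
  have "mixed_diff i j (potential s) x y
      = (\<Sum>k\<in>{1..p - 2}. mixed_diff i j (\<lambda>x y. int (s k) * int (x choose k) * int (y choose (p - 1 - k))) x y)"
    unfolding potential_def[abs_def] by (rule mixed_diff_sum)
  also have "\<dots> = (\<Sum>k\<in>{1..p - 2}. if i = k then int (s k) else 0)"
  proof (rule sum.cong)
    fix k assume k: "k \<in> {1..p - 2}"
    have "mixed_diff i j (\<lambda>x y. int (s k) * int (x choose k) * int (y choose (p - 1 - k))) x y
        = fdiff i (\<lambda>x. int (x choose k) * int (s k)) x * fdiff j (\<lambda>y. int (y choose (p - 1 - k))) y"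
      unfolding mult.commute[of "int (s k)"] by (rule mixed_diff_prod)
    also have "\<dots> = (if i = k then int (s k) else 0)"
      using k assms by (auto simp: fdiff_mult_right fdiff_choose)
    finally show "mixed_diff i j (\<lambda>x y. int (s k) * int (x choose k) * int (y choose (p - 1 - k))) x y
        = (if i = k then int (s k) else 0)" .
  qed simp
  finally show ?thesis by simp
qed

lemma potential_in_W: "potential s \<in> W"
proof -
  have "[potential s x y = potential s x' y'] (mod int p)"
    if "[x = x'] (mod p)" "[y = y'] (mod p)" for x x' y y'
    unfolding potential_def
  proof (intro cong_sum cong_mult cong_refl)
    fix i assume i: "i \<in> {1..p - 2}"
    show "[int (x choose i) = int (x' choose i)] (mod int p)"
      using i that p_gt_1 choose_mod_prime_periodic[OF prime_p] by (auto simp: cong_int_iff)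
    show "[int (y choose (p - 1 - i)) = int (y' choose (p - 1 - i))] (mod int p)"
      using i that p_gt_1 choose_mod_prime_periodic[OF prime_p] by (auto simp: cong_int_iff)
  qed
  then have per: "periodic (potential s)" by (simp add: periodic_def)
  have "(\<lambda>x y. potential s (x + a) (y + b) - potential s x y) \<in> V" for a b
    using per by (simp add: V_def periodic_diff periodic_shift mixed_diff_diff mixed_diff_shift
        mixed_diff_potential)
  with per show ?thesis by (simp add: W_def)
qed

text \<open>
  For a potential the differences in the conjugacy invariant are constant functions, so the unknown
  translation in the invariant has no influence and the coefficients are recovered modulo \<open>p\<close>.
\<close>

lemma orbit_determines_potential:
  assumes H: "elementary_abelian p 3 H"
    and s: "s \<in> {1..p - 2} \<rightarrow>\<^sub>E {..<p}" and s': "s' \<in> {1..p - 2} \<rightarrow>\<^sub>E {..<p}"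
    and orb: "orbit (perm_group \<Omega> \<Gamma>) (conj_action \<Omega> \<Gamma> H) (twisted_group (potential s))
      = orbit (perm_group \<Omega> \<Gamma>) (conj_action \<Omega> \<Gamma> H) (twisted_group (potential s'))"
  shows "s = s'"
proof -
  interpret G: group "perm_group \<Omega> \<Gamma>" by (rule perm_group_group[OF \<Gamma>_subgroup])
  let ?R = "twisted_group (potential s)" and ?R' = "twisted_group (potential s')"
  have sub: "?R \<subseteq> \<Gamma>" "?R' \<subseteq> \<Gamma>" using twisted_subset_\<Gamma>[OF potential_in_W] by blast+
  have Reg: "?R \<in> Reg \<Omega> \<Gamma> H" "?R' \<in> Reg \<Omega> \<Gamma> H"
    using twisted_in_Reg[OF potential_in_W H] by blast+
  have "conj_action \<Omega> \<Gamma> H \<one>\<^bsub>perm_group \<Omega> \<Gamma>\<^esub> ?R' = ?R'"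
    using Reg(2) sub(2) G.lcos_mult_one[of ?R'] G.coset_mult_one[of ?R']
    unfolding conj_action_def G.inv_one by simp
  then have "?R' \<in> orbit (perm_group \<Omega> \<Gamma>) (conj_action \<Omega> \<Gamma> H) ?R"
    unfolding orb unfolding orbit_def using G.one_closed by (metis (mono_tags, lifting) mem_Collect_eq)
  then obtain g where g: "g \<in> \<Gamma>" and R': "?R' = conj_action \<Omega> \<Gamma> H g ?R"
    by (auto simp: orbit_def)
  have conj: "\<exists>t'\<in>?R'. compose \<Omega> g t = compose \<Omega> t' g" if t: "t \<in> ?R" for t
  proof -
    let ?t' = "g \<otimes>\<^bsub>perm_group \<Omega> \<Gamma>\<^esub> t \<otimes>\<^bsub>perm_group \<Omega> \<Gamma>\<^esub> inv\<^bsub>perm_group \<Omega> \<Gamma>\<^esub> g"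
    have "?t' \<in> ?R'"
      unfolding R' conj_action_def using Reg(1) t by (auto simp: l_coset_def r_coset_def)
    moreover have "?t' \<otimes>\<^bsub>perm_group \<Omega> \<Gamma>\<^esub> g = g \<otimes>\<^bsub>perm_group \<Omega> \<Gamma>\<^esub> t"
    proof -
      have "g \<in> carrier (perm_group \<Omega> \<Gamma>)" "t \<in> carrier (perm_group \<Omega> \<Gamma>)"
        using g t sub by auto
      then show ?thesis using G.inv_closed G.m_assoc G.m_closed G.l_inv G.r_one by metis
    qed
    moreover have "t \<in> \<Gamma>" "?t' \<in> \<Gamma>" using t calculation(1) sub by blast+
    ultimately have "compose \<Omega> g t = compose \<Omega> ?t' g"
      using g by (simp only: perm_group_mult[OF \<Gamma>_subgroup, symmetric])
    then show ?thesis using \<open>?t' \<in> ?R'\<close> by (rule bexI)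
  qed
  obtain a b where ab: "\<forall>i j x y. Suc i + Suc j = p - 1 \<longrightarrow>
    [mixed_diff (Suc i) (Suc j) (potential s) x y
      = mixed_diff (Suc i) (Suc j) (potential s') (x + a) (y + b)] (mod int p)"
    using conjugate_twisted_invariant[OF potential_in_W potential_in_W g conj] by blast
  show "s = s'"
  proof (rule PiE_ext[OF s s'])
    fix i assume i: "i \<in> {1..p - 2}"
    then have ij: "Suc (i - 1) = i" "Suc (p - 2 - i) = p - 1 - i" "i + (p - 1 - i) = p - 1" by auto
    have "[mixed_diff i (p - 1 - i) (potential s) 0 0
        = mixed_diff i (p - 1 - i) (potential s') (0 + a) (0 + b)] (mod int p)"
      using ab[rule_format, of "i - 1" "p - 2 - i" 0 0, unfolded ij(1,2), OF ij(3)] .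
    then have "[int (s i) = int (s' i)] (mod int p)"
      unfolding mixed_diff_potential[OF ij(3)] using i by simp
    moreover have "s i < p" "s' i < p" using PiE_mem[OF s i] PiE_mem[OF s' i] by auto
    ultimately show "s i = s' i" by (simp add: cong_int_iff cong_def)
  qed
qed

lemma num_reg_classes_lower_bound:
  assumes H: "elementary_abelian p 3 H"
  shows "p ^ (p - 2) \<le> num_reg_classes \<Omega> \<Gamma> H"
proof -
  let ?S = "{1..p - 2} \<rightarrow>\<^sub>E {..<p}"
  let ?F = "\<lambda>s. orbit (perm_group \<Omega> \<Gamma>) (conj_action \<Omega> \<Gamma> H) (twisted_group (potential s))"
  \<comment> \<open>The number of classes is a cardinality, which is 0 for infinite sets, so finiteness is essential.\<close>
  have "Reg \<Omega> \<Gamma> H \<subseteq> Pow \<Gamma>"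
  proof
    fix R assume "R \<in> Reg \<Omega> \<Gamma> H"
    then have "subgroup R (perm_group \<Omega> \<Gamma>)" by (simp add: Reg_def)
    then have "R \<subseteq> carrier (perm_group \<Omega> \<Gamma>)" by (rule subgroup.subset)
    then show "R \<in> Pow \<Gamma>" by simp
  qed
  then have fin: "finite (orbits (perm_group \<Omega> \<Gamma>) (Reg \<Omega> \<Gamma> H) (conj_action \<Omega> \<Gamma> H))"
    using finite_subset finite_\<Gamma> by (fastforce simp: orbits_def)
  have inj: "inj_on ?F ?S"
    using orbit_determines_potential[OF H] by (intro inj_onI) blast
  have "?F ` ?S \<subseteq> orbits (perm_group \<Omega> \<Gamma>) (Reg \<Omega> \<Gamma> H) (conj_action \<Omega> \<Gamma> H)"
    using twisted_in_Reg[OF potential_in_W H] by (auto simp: orbits_def)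
  from card_inj_on_le[OF inj this fin] show ?thesis
    by (simp add: num_reg_classes_def card_PiE)
qed

end

theorem theorem1p1:
  fixes p :: nat and H :: "('h, 'm) monoid_scheme"
  assumes "prime p" and "elementary_abelian p 3 H"
  shows "\<exists>(\<Omega> :: nat set) \<Gamma>. \<Gamma> \<in> class_E p \<Omega> \<and> num_reg_classes \<Omega> \<Gamma> H \<ge> p ^ (p - 2)"
proof -
  interpret prime_cube p by unfold_locales fact
  show ?thesis using \<Gamma>_in_class_E num_reg_classes_lower_bound[OF assms(2)] by blast
qed

end
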